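(* Let $q=2^h$ and let $\mathcal{A}$ be a KM-arc of type $q/4$ in $\mathrm{PG}(2,q)$. If $\ell$ is a $q/4$-secant of $\mathcal{A}$ such that $\mathcal{A}$ has property (I) with respect to $\ell$, then there exist $\alpha,\beta\in\mathbb{F}_q\setminus\{0,1\}$ with $\alpha\beta\neq1$ and $\alpha\beta^2=1$, and $a,b\in\mathbb{F}_2$, such that $\mathcal{A}$ is $\mathrm{PGL}(3,q)$-equivalent to $\mathcal{A}_{\alpha,\beta,a,b}$; hence $\mathcal{A}$ is a translation KM-arc with translation line $\ell$.
   Context: Let $\mathrm{Tr}$ be the absolute trace $\mathbb{F}_q\to\mathbb{F}_2$. For $\alpha,\beta\in\mathbb{F}_q\setminus\{0,1\}$, $\alpha\beta\ne1$, put $\gamma=\frac{\beta+1}{\alpha\beta+1}$, $\xi=\alpha\beta\gamma$; for $a,b\in\mathbb{F}_2$, $\mathcal{A}_{\alpha,\beta,a,b}$ is the union of $\{(z,1,0): \mathrm{Tr}(z)=0,\mathrm{Tr}(z/\alpha)=a\}$, $\{(z,0,1):\mathrm{Tr}(z)=0,\mathrm{Tr}(z/(\alpha\gamma))=0\}$, $\{(z,1,1):\mathrm{Tr}(z)=1,\mathrm{Tr}(z/(\alpha\beta))=b\}$, $\{(z,\gamma,1):\mathrm{Tr}(z/(\alpha\gamma))=a+1,\mathrm{Tr}(z/\xi)=b+1\}$, $\{(z,\beta+1,1):\mathrm{Tr}(z/(\alpha\beta))=a+b+1,\mathrm{Tr}(z/\xi)=b\}$ ($z\in\mathbb{F}_q$).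 A KM-arc of type $t$ is a set of $q+t$ points such that every line meets it in $0$, $2$ or $t$ points, each value occurring; a KM-arc of type $q/4$ has five $q/4$-secants, concurrent in its nucleus $N$. A set $S$ is a translation set with respect to a line $\ell$ (translation line) if the group of elations with axis $\ell$ fixing $S$ acts transitively on $S\setminus\ell$; a translation KM-arc is a KM-arc that is a translation set. An $\mathbb{F}_2$-linear set of rank $k$ on a line (viewed as $\mathrm{PG}(1,q)$) is the set of points defined by the nonzero vectors of a $k$-dimensional $\mathbb{F}_2$-subspace $W$ of $\mathbb{F}_q^2$; weight of $\langle v\rangle$ is $\dim_{\mathbb{F}_2}(W\cap\langle v\rangle_{\mathbb{F}_q})$; an $i$-club of rank $k$ has one point (head) of weight $i$, all others of weight $1$. With $\ell_0=\ell$ and the other secants $\ell_1,\dots,\ell_4$, $S_i=\ell_i\cap\mathcal{A}$, $D_{ij}=\{\langle P,Q\rangle\cap\ell_0: P\in S_i,Q\in S_j\}$: property (I) w.r.t. $\ell_0$ means (1) each $S_i\cup\{N\}$ ($i=1..4$) is an $\mathbb{F}_2$-linear $(h-2)$-club of rank $h-1$; (2) $D_{12}=D_{34}$, $D_{13}=D_{24}$, $D_{14}=D_{23}$; (3) $D_{12}\cup\{N\},D_{13}\cup\{N\},D_{14}\cup\{N\}$ are $\mathbb{F}_2$-linear $(h-2)$-clubs of rank $h-1$ with head $N$; (4) $D_{12},D_{13},D_{14}$ are pairwise disjoint. *)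

theory Defs
  imports "HOL-Analysis.Analysis" "HOL-Library.Z2"
begin

text \<open>
  The field with q elements is a type of class field and finite. A point of PG(2,q) is a
  one-dimensional subspace of the space of vectors of length 3; a line is the set of all points
  contained in a given two-dimensional subspace.
\<close>

type_synonym 'a pg_point = "('a ^ 3) set"
type_synonym 'a pg_line = "'a pg_point set"

definition pg_points :: "('a::field) pg_point set" where
  "pg_points = {P. vec.subspace P \<and> vec.dim P = 1}"

definition pg_lines :: "('a::field) pg_line set" where
  "pg_lines = {l. \<exists>U. vec.subspace U \<and> vec.dim U = 2 \<and> l = {P \<in> pg_points. P \<subseteq> U}}"

definition pg_pt :: "'a::field \<Rightarrow> 'a \<Rightarrow> 'a \<Rightarrow> 'a pg_point" where
  "pg_pt x y z = vec.span {vector [x, y, z]}"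

definition pg_join :: "('a::field) pg_point \<Rightarrow> 'a pg_point \<Rightarrow> 'a pg_line" where
  "pg_join P Q = {R \<in> pg_points. R \<subseteq> vec.span (P \<union> Q)}"

definition pgl_equivalent :: "('a::field) pg_point set \<Rightarrow> 'a pg_point set \<Rightarrow> bool" where
  "pgl_equivalent A B \<longleftrightarrow> (\<exists>M :: 'a ^ 3 ^ 3. invertible M \<and> (\<lambda>P. (\<lambda>v. M *v v) ` P) ` A = B)"

definition pg_collineation :: "('a::field pg_point \<Rightarrow> 'a pg_point) \<Rightarrow> bool" where
  "pg_collineation f \<longleftrightarrow> bij_betw f pg_points pg_points \<and> (\<forall>m \<in> pg_lines. f ` m \<in> pg_lines)"

text \<open>
  An elation with axis l fixes every point of l and, for some point C of l (its centre), every
  line through C. The identity is included.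
\<close>

definition pg_elation :: "('a::field) pg_line \<Rightarrow> ('a pg_point \<Rightarrow> 'a pg_point) \<Rightarrow> bool" where
  "pg_elation l f \<longleftrightarrow> pg_collineation f \<and> (\<forall>P \<in> l. f P = P) \<and>
     (\<exists>C \<in> l. \<forall>m \<in> pg_lines. C \<in> m \<longrightarrow> f ` m = m)"

definition translation_set :: "('a::field) pg_point set \<Rightarrow> 'a pg_line \<Rightarrow> bool" where
  "translation_set S l \<longleftrightarrow> S \<subseteq> pg_points \<and> l \<in> pg_lines \<and>
     (\<forall>P \<in> S - l. \<forall>Q \<in> S - l. \<exists>f. pg_elation l f \<and> f ` S = S \<and> f P = Q)"

definition km_arc :: "nat \<Rightarrow> ('a::{field,finite}) pg_point set \<Rightarrow> bool" where
  "km_arc t A \<longleftrightarrow> A \<subseteq> pg_points \<and> card A = CARD('a) + t \<and>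
     (\<forall>l \<in> pg_lines. card (A \<inter> l) \<in> {0, 2, t}) \<and>
     (\<forall>n \<in> {0, 2, t}. \<exists>l \<in> pg_lines. card (A \<inter> l) = n)"

definition secants :: "nat \<Rightarrow> ('a::field) pg_point set \<Rightarrow> 'a pg_line set" where
  "secants t A = {l \<in> pg_lines. card (A \<inter> l) = t}"

definition translation_km_arc :: "nat \<Rightarrow> ('a::{field,finite}) pg_point set \<Rightarrow> 'a pg_line \<Rightarrow> bool" where
  "translation_km_arc t A l \<longleftrightarrow> km_arc t A \<and> translation_set A l"

text \<open>
  The field with two elements is the type bit. In characteristic 2 the following scalar
  multiplication is the restriction of the one of the big field.
\<close>

definition f2_scale :: "bit \<Rightarrow> 'a::field ^ 'n \<Rightarrow> 'a ^ 'n" where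
  "f2_scale c v = (if c = 1 then v else 0)"

lemma vector_space_f2_scale:
  assumes "(1 :: 'a::field) + 1 = 0"
  shows "vector_space (f2_scale :: bit \<Rightarrow> 'a ^ 'n \<Rightarrow> 'a ^ 'n)"
proof
  have double: "v + v = 0" for v :: "'a ^ 'n"
  proof -
    have "x + x = 0" for x :: 'a
      using assms by (metis distrib_left mult.right_neutral mult_zero_right)
    then show ?thesis by (simp add: vec_eq_iff)
  qed
  fix c d :: bit and v w :: "'a ^ 'n"
  show "f2_scale c (v + w) = f2_scale c v + f2_scale c w"
    and "f2_scale c (f2_scale d v) = f2_scale (c * d) v"
    and "f2_scale 1 v = v"
    by (auto simp: f2_scale_def)
  show "f2_scale (c + d) v = f2_scale c v + f2_scale d v"
    by (cases c; cases d) (simp_all add: f2_scale_def double)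
qed

abbreviation f2_subspace :: "('a::field ^ 'n) set \<Rightarrow> bool" where
  "f2_subspace \<equiv> module.subspace f2_scale"

abbreviation f2_dim :: "('a::field ^ 'n) set \<Rightarrow> nat" where
  "f2_dim \<equiv> vector_space.dim f2_scale"

definition points_of :: "('a::field ^ 3) set \<Rightarrow> 'a pg_point set" where
  "points_of W = {vec.span {v} | v. v \<in> W \<and> v \<noteq> 0}"

definition f2_weight :: "('a::field ^ 3) set \<Rightarrow> 'a pg_point \<Rightarrow> nat" where
  "f2_weight W P = f2_dim (W \<inter> P)"

text \<open>
  The union of the points of l is the two-dimensional space underlying l; through any basis of
  it l is identified with PG(1,q).
\<close>

definition f2_club_with_head ::
    "nat \<Rightarrow> nat \<Rightarrow> ('a::field) pg_line \<Rightarrow> 'a pg_point \<Rightarrow> 'a pg_point set \<Rightarrow> bool" where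
  "f2_club_with_head i k l H X \<longleftrightarrow>
     (\<exists>W. f2_subspace W \<and> W \<subseteq> \<Union>l \<and> f2_dim W = k \<and> X = points_of W \<and>
        H \<in> X \<and> f2_weight W H = i \<and> (\<forall>P \<in> X - {H}. f2_weight W P = 1))"

definition f2_club :: "nat \<Rightarrow> nat \<Rightarrow> ('a::field) pg_line \<Rightarrow> 'a pg_point set \<Rightarrow> bool" where
  "f2_club i k l X \<longleftrightarrow> (\<exists>H. f2_club_with_head i k l H X)"

definition dir_set ::
    "('a::field) pg_line \<Rightarrow> 'a pg_point set \<Rightarrow> 'a pg_point set \<Rightarrow> 'a pg_point set" where
  "dir_set l0 S T = (\<Union>P \<in> S. \<Union>Q \<in> T. pg_join P Q \<inter> l0)"

text \<open>
  For an arc of type t = q/4 with q = 2 ^ h the map l enumerates the five t-secants, beginning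
  with l0, and N is the nucleus, their common point.
\<close>

definition property_I :: "nat \<Rightarrow> nat \<Rightarrow> ('a::field) pg_point set \<Rightarrow> 'a pg_line \<Rightarrow> bool" where
  "property_I h t A l0 \<longleftrightarrow>
    (\<exists>(l :: nat \<Rightarrow> 'a pg_line) N.
       bij_betw l {0..4} (secants t A) \<and> l 0 = l0 \<and>
       N \<in> pg_points \<and> (\<forall>i \<in> {0..4}. N \<in> l i) \<and>
       (let S = (\<lambda>i. l i \<inter> A); D = (\<lambda>i j. dir_set l0 (S i) (S j)) in
          (\<forall>i \<in> {1..4}. f2_club (h - 2) (h - 1) (l i) (S i \<union> {N})) \<and>
          D 1 2 = D 3 4 \<and> D 1 3 = D 2 4 \<and> D 1 4 = D 2 3 \<and>
          (\<forall>j \<in> {2, 3, 4}. f2_club_with_head (h - 2) (h - 1) l0 N (D 1 j \<union> {N})) \<and>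
          D 1 2 \<inter> D 1 3 = {} \<and> D 1 2 \<inter> D 1 4 = {} \<and> D 1 3 \<inter> D 1 4 = {}))"

text \<open>
  Absolute trace of the field with 2 ^ h elements; its values 0 and 1, as well as the parameters
  a and b below, are taken in the prime subfield {0,1} of the big field.
\<close>

definition abs_trace :: "nat \<Rightarrow> 'a::field \<Rightarrow> 'a" where
  "abs_trace h x = (\<Sum>i<h. x ^ (2 ^ i))"

definition arc_family :: "nat \<Rightarrow> 'a::field \<Rightarrow> 'a \<Rightarrow> 'a \<Rightarrow> 'a \<Rightarrow> 'a pg_point set" where
  "arc_family h \<alpha> \<beta> a b =
    (let Tr = abs_trace h; \<gamma> = (\<beta> + 1) / (\<alpha> * \<beta> + 1); \<xi> = \<alpha> * \<beta> * \<gamma> in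
       {pg_pt z 1 0 | z. Tr z = 0 \<and> Tr (z / \<alpha>) = a} \<union>
       {pg_pt z 0 1 | z. Tr z = 0 \<and> Tr (z / (\<alpha> * \<gamma>)) = 0} \<union>
       {pg_pt z 1 1 | z. Tr z = 1 \<and> Tr (z / (\<alpha> * \<beta>)) = b} \<union>
       {pg_pt z \<gamma> 1 | z. Tr (z / (\<alpha> * \<gamma>)) = a + 1 \<and> Tr (z / \<xi>) = b + 1} \<union>
       {pg_pt z (\<beta> + 1) 1 | z. Tr (z / (\<alpha> * \<beta>)) = a + b + 1 \<and> Tr (z / \<xi>) = b})"

end

theory Submission
  imports Defs
begin

text \<open>
  Choose coordinates such that the nucleus is \<open>(1, 0, 0)\<close>, the line \<open>l\<close> has equation \<open>z = 0\<close>, and the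
  first two of the other four secants are at the heights \<open>0\<close> and \<open>1\<close>, each with a point of the arc
  at \<open>x = 0\<close>. A club with head \<open>N\<close> is a coset of an additive subgroup of index 4, so the sets
  \<open>S\<^sub>1\<close>, \<open>S\<^sub>2\<close> are the same subgroup \<open>U\<close>, and \<open>S\<^sub>3\<close>, \<open>S\<^sub>4\<close>, at heights \<open>y\<close> and \<open>y'\<close>, are cosets of \<open>U\<close>.
  By \<open>D\<^sub>1\<^sub>2 = D\<^sub>3\<^sub>4\<close> multiplication by \<open>y + y'\<close> preserves \<open>U\<close>. The orthogonal complement of \<open>U\<close> for the
  trace form has only three nonzero elements; with the disjointness of the direction sets this
  forces \<open>y' = y + 1\<close> and yields \<open>a\<close> such that \<open>U\<close> is cut out by \<open>Tr (a x) = Tr (y a x) = 0\<close> and the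
  coset by \<open>Tr (a x) = 1\<close>. Hence the affine part of the arc is an additive group, whose translations
  are elations, the points on \<open>l\<close> are the remaining directions, and a shear with scaling
  leads to the family with \<open>\<beta> = y\<close> and \<open>\<alpha> = 1 / y\<^sup>2\<close>.
\<close>

section \<open>Trace duality in a field of characteristic two\<close>

text \<open>Multiplication by \<open>x\<close> permutes the nonzero elements, so their product,
  which is nonzero, absorbs the factor \<open>x ^ (CARD('a) - 1)\<close>.\<close>

lemma finite_field_power_card:
  fixes x :: "'a::{field,finite}"
  shows "x ^ CARD('a) = x"
proof (cases "x = 0")
  case False
  have "x * (\<Prod>y\<in>UNIV - {0}. x * y) = x * x ^ (CARD('a) - 1) * \<Prod>(UNIV - {0})"
    by (simp add: prod.distrib mult_ac card_Diff_singleton)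
  also have "x * x ^ (CARD('a) - 1) = x ^ CARD('a)"
    by (subst power_Suc [symmetric]) auto
  also have "(\<Prod>y\<in>UNIV - {0}. x * y) = \<Prod>(UNIV - {0})"
    by (rule prod.reindex_bij_witness [of _ "\<lambda>y. y / x" "\<lambda>y. x * y"]) (use False in auto)
  finally show ?thesis by simp
qed (simp add: power_0_left)

text \<open>The shift by 1 permutes the field and leaves the sum of all elements unchanged, so
  \<open>CARD('a)\<close> times 1 vanishes; as this is a power of 2, the element 2 itself is
  0.\<close>

lemma double_zero_of_card:
  fixes x :: "'a::{field,finite}"
  assumes "CARD('a) = 2 ^ h"
  shows "x + x = 0"
proof -
  have "(\<Sum>y\<in>UNIV. y + 1) = (\<Sum>y\<in>(UNIV::'a set). y)"
    by (rule sum.reindex_bij_witness [of _ "\<lambda>y. y - 1" "\<lambda>y. y + 1"]) auto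
  then have "of_nat (CARD('a)) = (0::'a)"
    by (simp add: sum.distrib)
  then have "(2::'a) = 0"
    using assms by simp
  then have "(2::'a) * x = 0" by simp
  then show ?thesis by (simp only: mult_2)
qed

text \<open>The \<open>itself\<close> parameter ties the type \<open>'a\<close> to the locale, so
  that an interpretation can name the field.\<close>

locale binary_field =
  fixes h :: nat and field_type :: "'a::{field,finite} itself"
  assumes card_field: "CARD('a) = 2 ^ h"
begin

section \<open>Arithmetic in characteristic two\<close>

lemma double [simp]: "x + x = (0::'a)"
  using double_zero_of_card [OF card_field] .

lemma double_left [simp]: "x + (x + y) = (y::'a)"
  by (simp add: add.assoc [symmetric])

lemma minus_eq [simp]: "- x = (x::'a)"
  by (simp add: minus_unique)

text \<open>As a simp rule this turns differences into sums, where equal terms cancel by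
  \<open>double\<close> and \<open>double_left\<close>.\<close>

lemma diff_eq [simp]: "x - y = x + (y::'a)"
  by (simp add: diff_conv_add_uminus del: add_uminus_conv_diff)

lemma add_eq_0 [simp]: "x + y = 0 \<longleftrightarrow> x = (y::'a)"
  using eq_neg_iff_add_eq_0 [of x y] by simp

lemma two_zero [simp]: "(2::'a) = 0"
  by (metis double one_add_one)

lemma square_add: "(x + y)\<^sup>2 = x\<^sup>2 + (y::'a)\<^sup>2"
  by (simp add: power2_sum)

lemma frobenius_add: "(x + y) ^ (2 ^ i) = x ^ (2 ^ i) + (y::'a) ^ (2 ^ i)"
proof (induction i)
  case (Suc i)
  have "(x + y) ^ (2 ^ Suc i) = ((x + y) ^ (2 ^ i))\<^sup>2"
    by (simp add: power_mult [symmetric] mult.commute)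
  then show ?case
    by (simp add: Suc square_add power_mult [symmetric] mult.commute)
qed simp

section \<open>The absolute trace as an additive map onto the prime field\<close>

abbreviation Tr :: "'a \<Rightarrow> 'a" where "Tr \<equiv> abs_trace h"

lemma Tr_add [simp]: "Tr (x + y) = Tr x + Tr y"
  by (simp add: abs_trace_def frobenius_add sum.distrib)

lemma Tr_0 [simp]: "Tr 0 = 0"
  using Tr_add [of 0 0] by simp

lemma h_pos: "0 < h"
proof (rule ccontr)
  assume "\<not> 0 < h"
  then have "CARD('a) = 1" using card_field by simp
  then show False
    by (metis (full_types) UNIV_I card_1_singletonE singletonD zero_neq_one)
qed

text \<open>Squaring permutes the summands \<open>x ^ (2 ^ i)\<close> cyclically, because
  \<open>x ^ (2 ^ h) = x\<close>.\<close>

lemma Tr_square: "(Tr x)\<^sup>2 = Tr x"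
proof -
  have sq: "(\<Sum>i<n. f i)\<^sup>2 = (\<Sum>i<n. (f i)\<^sup>2)" for n and f :: "nat \<Rightarrow> 'a"
    by (induction n) (simp_all add: square_add)
  have "(Tr x)\<^sup>2 = (\<Sum>i<h. x ^ (2 ^ Suc i))"
    by (simp add: abs_trace_def sq power_mult [symmetric] mult.commute)
  \<comment> \<open>Adding \<open>x\<close> supplies the term of index 0; the same
    \<open>Suc h\<close> terms, split at the other end, give \<open>Tr x + x\<close>.\<close>
  also have "\<dots> + x = (\<Sum>i<Suc h. x ^ (2 ^ i))"
    by (subst sum.lessThan_Suc_shift) (simp add: add.commute)
  also have "\<dots> = Tr x + x"
    using finite_field_power_card [of x] card_field by (simp add: abs_trace_def)
  finally show ?thesis by simp
qed

lemma Tr_cases: "Tr x = 0 \<or> Tr x = 1"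
proof -
  have "Tr x * (Tr x + 1) = 0"
    using Tr_square [of x] by (simp add: algebra_simps power2_eq_square)
  then show ?thesis by auto
qed

text \<open>The trace is a nonzero polynomial of degree at most q / 2, so it cannot vanish at all q
  field elements.\<close>

lemma Tr_surj: "\<exists>x. Tr x = 1"
proof (rule ccontr)
  assume *: "\<nexists>x. Tr x = 1"
  define p :: "'a poly" where "p = (\<Sum>i<h. monom 1 (2 ^ i))"
  have poly: "poly p x = Tr x" for x
    by (simp add: p_def abs_trace_def poly_sum poly_monom)
  \<comment> \<open>The coefficient of the linear term is 1, which shows that \<open>p\<close> is
    not the zero polynomial.\<close>
  have "coeff p (2 ^ 0) = (\<Sum>i<h. if i = 0 then 1 else 0)"
    unfolding p_def coeff_sum by (intro sum.cong) (auto)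
  then have "p \<noteq> 0"
    using h_pos by auto
  have "degree p \<le> 2 ^ (h - 1)"
    unfolding p_def by (intro degree_sum_le) (auto simp: degree_monom_eq)
  moreover have "card {x. poly p x = 0} \<le> degree p"
    using \<open>p \<noteq> 0\<close> by (rule card_poly_roots_bound)
  moreover have "{x. poly p x = 0} = UNIV"
    using * Tr_cases by (auto simp: poly)
  ultimately have "(2::nat) ^ h \<le> 2 ^ (h - 1)"
    by (metis card_field le_trans)
  then have "h \<le> h - 1" by (rule power_le_imp_le_exp [rotated]) simp
  then show False using h_pos by simp
qed

section \<open>Subgroups and their orthogonal complements for the trace form\<close>

definition add_subgroup :: "'a set \<Rightarrow> bool" where
  "add_subgroup U \<longleftrightarrow> 0 \<in> U \<and> (\<forall>x\<in>U. \<forall>y\<in>U. x + y \<in> U)"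

definition perp :: "'a set \<Rightarrow> 'a set" where
  "perp U = {a. \<forall>u\<in>U. Tr (a * u) = 0}"

text \<open>The additive character (-1)^Tr x, with integer values so that its sums can be compared
  with cardinalities.\<close>

definition sgn_Tr :: "'a \<Rightarrow> int" where
  "sgn_Tr x = (if Tr x = 0 then 1 else -1)"

lemma sgn_Tr_add: "sgn_Tr (x + y) = sgn_Tr x * sgn_Tr y"
  using Tr_cases [of x] Tr_cases [of y] by (auto simp: sgn_Tr_def)

text \<open>Orthogonality of characters: a nontrivial character changes sign under translation by
  some \<open>v \<in> U\<close>, so its sum over \<open>U\<close> equals its own negative.\<close>

lemma sum_sgn_Tr:
  assumes U: "add_subgroup U"
  shows "(\<Sum>u\<in>U. sgn_Tr (a * u)) = (if a \<in> perp U then int (card U) else 0)"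
proof (cases "a \<in> perp U")
  case True
  then show ?thesis by (simp add: perp_def sgn_Tr_def)
next
  case False
  then obtain v where v: "v \<in> U" "Tr (a * v) \<noteq> 0" by (auto simp: perp_def)
  have "(\<Sum>u\<in>U. sgn_Tr (a * u)) = (\<Sum>u\<in>U. sgn_Tr (a * (u + v)))"
    by (rule sum.reindex_bij_witness [of _ "\<lambda>u. u + v" "\<lambda>u. u + v"])
      (use U v in \<open>auto simp: add_subgroup_def add.assoc\<close>)
  also have "\<dots> = - (\<Sum>u\<in>U. sgn_Tr (a * u))"
    using v by (simp add: distrib_left sgn_Tr_add sum_negf sgn_Tr_def [of "a * v"])
  finally show ?thesis using False by simp
qed

text \<open>Double counting of the character sum of \<open>(-1) ^ Tr (a * u)\<close> over \<open>a\<close> and \<open>u \<in> U\<close>.\<close>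

lemma card_perp:
  assumes U: "add_subgroup U"
  shows "card (perp U) * card U = CARD('a)"
proof -
  have add: "add_subgroup UNIV" by (simp add: add_subgroup_def)
  \<comment> \<open>Nondegeneracy of the trace form; when the sum over \<open>a\<close> is evaluated
    first, only \<open>u = 0\<close> contributes.\<close>
  have perp_UNIV: "perp UNIV = {0}"
  proof -
    have "a = 0" if "\<forall>u. Tr (a * u) = 0" for a
    proof (rule ccontr)
      assume "a \<noteq> 0"
      obtain x where "Tr x = 1" using Tr_surj by blast
      then show False using that [rule_format, of "x / a"] \<open>a \<noteq> 0\<close> by simp
    qed
    then show ?thesis by (auto simp: perp_def)
  qed
  have "int (card (perp U) * card U) = (\<Sum>a\<in>UNIV. \<Sum>u\<in>U. sgn_Tr (a * u))"
    by (simp add: sum_sgn_Tr [OF U] sum.If_cases mult.commute)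
  also have "\<dots> = (\<Sum>u\<in>U. \<Sum>a\<in>UNIV. sgn_Tr (u * a))"
    by (subst sum.swap) (simp add: mult.commute)
  also have "\<dots> = (\<Sum>u\<in>U. if u = 0 then int (CARD('a)) else 0)"
    by (simp only: sum_sgn_Tr [OF add] perp_UNIV) simp
  also have "\<dots> = int (CARD('a))"
    using U by (simp add: sum.delta add_subgroup_def)
  finally show ?thesis by (simp only: of_nat_eq_iff)
qed

lemma add_subgroup_perp: "add_subgroup (perp U)"
  by (simp add: add_subgroup_def perp_def distrib_right)

text \<open>If all of \<open>perp U\<close> vanished at \<open>c\<close>, adjoining \<open>c\<close>
  would double the group and leave its complement unchanged, against
  \<open>card_perp\<close>.\<close>

lemma perp_separates:
  assumes U: "add_subgroup U" and c: "c \<notin> U"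
  shows "\<exists>a\<in>perp U. Tr (a * c) = 1"
proof (rule ccontr)
  assume "\<not> ?thesis"
  then have *: "Tr (a * c) = 0" if "a \<in> perp U" for a
    using Tr_cases that by blast
  define V where "V = U \<union> (+) c ` U"
  have V: "add_subgroup V"
    using U by (auto simp: V_def add_subgroup_def add_ac image_iff)
  have "U \<inter> (+) c ` U = {}"
    using U c by (auto simp: add_subgroup_def) (metis add.assoc add.commute double_left)
  then have card: "card V = 2 * card U"
    by (simp add: V_def card_Un_disjoint card_image)
  have "perp V = perp U"
    using * by (auto simp: perp_def V_def distrib_left)
  then show False
    using card_perp [OF U] card_perp [OF V] card by (metis mult.left_commute mult_2 zero_less_card_finite add_cancel_right_right less_irrefl)
qed

text \<open>A subgroup of index 4 has a complement of order 4, and the four listed elements are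
  distinct members of it.\<close>

lemma perp_eqI:
  assumes U: "add_subgroup U" "4 * card U = CARD('a)"
    and a: "a \<in> perp U" "a \<noteq> 0" "y * a \<in> perp U" "y \<noteq> 0" "y \<noteq> 1"
  shows "perp U = {0, a, y * a, (1 + y) * a}"
proof -
  have c: "card U \<noteq> 0" using U by (metis card_eq_0_iff finite mult_0_right zero_less_card_finite less_irrefl)
  have "card (perp U) = 4"
    using card_perp [OF U(1)] U(2) c by (metis mult_right_cancel)
  moreover have "card {0, a, y * a, (1 + y) * a} = 4"
    using a by (auto simp: card_insert_if distrib_right)
  moreover have "{0, a, y * a, (1 + y) * a} \<subseteq> perp U"
    using a add_subgroup_perp [of U] by (auto simp: add_subgroup_def distrib_right)
  ultimately show ?thesis by (metis card_subset_eq finite)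
qed

text \<open>Multiplication by \<open>k\<close> is self-adjoint for the trace form, so the complement
  of a \<open>k\<close>-invariant group is \<open>k\<close>-invariant too.\<close>

lemma perp_multiplier:
  assumes U: "add_subgroup U" "4 * card U = CARD('a)" and k: "\<And>u. u \<in> U \<Longrightarrow> k * u \<in> U"
    and a: "a \<in> perp U" "a \<noteq> 0" and k1: "k \<noteq> 0" "k \<noteq> 1"
  shows "perp U = {0, a, k * a, (1 + k) * a}"
proof (rule perp_eqI [OF U a _ k1])
  have "Tr (a * (k * u)) = 0" if "u \<in> U" for u
    using a(1) k [OF that] unfolding perp_def by blast
  moreover have "a * (k * u) = k * a * u" for u by (simp only: mult_ac)
  ultimately show "k * a \<in> perp U" unfolding perp_def by simp
qed

text \<open>The picture is \<open>U\<close> at the heights 0 and 1, and the cosets of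
  \<open>c\<close> and \<open>c'\<close> at the heights \<open>y\<close> and \<open>y'\<close>.
  Assumption \<open>D\<close> states that \<open>D_12\<close> is contained in \<open>D_34\<close>;
  \<open>disj\<close> states that \<open>D_12\<close> is disjoint from \<open>D_13\<close> and
  \<open>D_14\<close>. A complement of order 4 leaves too little room unless
  \<open>y + y' = 1\<close>.\<close>

lemma coset_arrangement:
  assumes U: "add_subgroup U" "4 * card U = CARD('a)"
    and y: "y \<noteq> 0" "y \<noteq> 1" "y' \<noteq> 0" "y' \<noteq> 1" "y \<noteq> y'"
    and D: "\<And>u. u \<in> U \<Longrightarrow> \<exists>v\<in>U. u = (c + c' + v) / (y + y')"
    and disj: "\<And>u v. u \<in> U \<Longrightarrow> v \<in> U \<Longrightarrow> c + u \<noteq> y * v"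
      "\<And>u v. u \<in> U \<Longrightarrow> v \<in> U \<Longrightarrow> c' + u \<noteq> y' * v"
  obtains a where "y' = y + 1" "c + c' \<in> U" "Tr (a * c) = 1"
    "U = {x. Tr (a * x) = 0 \<and> Tr (y * a * x) = 0}"
proof -
  define k where "k = y + y'"
  have k0: "k \<noteq> 0" using y by (simp add: k_def)
  have zero: "0 \<in> U" and add: "\<And>u v. u \<in> U \<Longrightarrow> v \<in> U \<Longrightarrow> u + v \<in> U"
    using U by (auto simp: add_subgroup_def)
  \<comment> \<open>The parameter 0 gives \<open>c + c' \<in> U\<close>; after that,
    \<open>D\<close> says that \<open>k\<close> maps \<open>U\<close> into itself.\<close>
  obtain u0 where "u0 \<in> U" "0 = (c + c' + u0) / k"
    using D [OF zero] unfolding k_def by blast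
  then have cc: "c + c' \<in> U" using k0 by auto
  have kU: "k * u \<in> U" if "u \<in> U" for u
  proof -
    obtain v where "v \<in> U" "u = (c + c' + v) / k"
      using D [OF \<open>u \<in> U\<close>] unfolding k_def by blast
    then have "k * u = (c + c') + v" using k0 by simp
    then show ?thesis using add [OF cc \<open>v \<in> U\<close>] by simp
  qed
  \<comment> \<open>The assumption on \<open>d\<close> says that it lies outside the group
    \<open>U + z * U\<close>. An element \<open>a\<close> separating \<open>d\<close> from this
    group is orthogonal to both summands, hence \<open>a\<close> and \<open>z * a\<close> are both
    in \<open>perp U\<close>.\<close>
  have ex: "\<exists>a. a \<in> perp U \<and> z * a \<in> perp U \<and> Tr (a * d) = 1"
    if "\<And>u v. u \<in> U \<Longrightarrow> v \<in> U \<Longrightarrow> d + u \<noteq> z * v" for z d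
  proof -
    define V where "V = (\<lambda>(u, v). u + z * v) ` (U \<times> U)"
    have V: "add_subgroup V"
      unfolding add_subgroup_def
    proof (intro conjI ballI)
      show "0 \<in> V" using zero unfolding V_def by (intro image_eqI [of _ _ "(0, 0)"]) auto
      fix p q assume "p \<in> V" "q \<in> V"
      then obtain u v u' v' where "u \<in> U" "v \<in> U" "u' \<in> U" "v' \<in> U" "p = u + z * v" "q = u' + z * v'"
        by (auto simp: V_def)
      then have "p + q = (u + u') + z * (v + v')" "u + u' \<in> U" "v + v' \<in> U"
        by (simp_all only: add distrib_left add_ac)
      then show "p + q \<in> V"
        unfolding V_def by (intro image_eqI [of _ _ "(u + u', v + v')"]) simp_all
    qed
    have "d \<notin> V"
    proof
      assume "d \<in> V"
      then obtain u v where uv: "u \<in> U" "v \<in> U" "d = u + z * v" by (auto simp: V_def)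
      then have "d + u = z * v" by (simp add: add_ac)
      then show False using that uv by blast
    qed
    then obtain a where a: "a \<in> perp V" "Tr (a * d) = 1"
      using perp_separates [OF V] by blast
    have "u \<in> V" if "u \<in> U" for u
      using that zero unfolding V_def by (intro image_eqI [of _ _ "(u, 0)"]) auto
    moreover have "z * u \<in> V" if "u \<in> U" for u
      using that zero unfolding V_def by (intro image_eqI [of _ _ "(0, u)"]) auto
    moreover have "z * a * u = a * (z * u)" for u by (simp only: mult_ac)
    ultimately have "a \<in> perp U \<and> z * a \<in> perp U"
      using a(1) unfolding perp_def mem_Collect_eq by metis
    with a show ?thesis by blast
  qed
  obtain a where a: "a \<in> perp U" "y * a \<in> perp U" "Tr (a * c) = 1"
    using ex [OF disj(1)] by blast
  have a0: "a \<noteq> 0" using a by auto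
  obtain a' where a': "a' \<in> perp U" "y' * a' \<in> perp U" "Tr (a' * c') = 1"
    using ex [OF disj(2)] by blast
  have a'0: "a' \<noteq> 0" using a' by auto
  \<comment> \<open>Otherwise \<open>y\<close> and \<open>y'\<close> are the two elements \<open>k\<close> and \<open>1 + k\<close>, whose sum is not \<open>k\<close>.\<close>
  have k1: "k = 1"
  proof (rule ccontr)
    assume k1: "k \<noteq> 1"
    have m: "perp U = {0, b, k * b, (1 + k) * b}" if "b \<in> perp U" "b \<noteq> 0" for b
      using perp_multiplier [OF U _ that k0 k1] kU by blast
    have "y * a \<in> {0 * a, 1 * a, k * a, (1 + k) * a}" using m [OF a(1) a0] a(2) by simp
    then have "y = k \<or> y = 1 + k" using a0 y by simp
    moreover have "y' * a' \<in> {0 * a', 1 * a', k * a', (1 + k) * a'}"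
      using m [OF a'(1) a'0] a'(2) by simp
    then have "y' = k \<or> y' = 1 + k" using a'0 y by simp
    ultimately show False using y k1 by (auto simp: k_def add_ac)
  qed
  have P: "perp U = {0, a, y * a, (1 + y) * a}"
    using perp_eqI [OF U a(1) a0 a(2) y(1,2)] .
  \<comment> \<open>\<open>U\<close> lies in the solution set \<open>K\<close> of the two trace
    equations; as both have the same complement, they have the same size.\<close>
  define K where "K = {x. Tr (a * x) = 0 \<and> Tr (y * a * x) = 0}"
  have UK: "U \<subseteq> K" using a by (auto simp: perp_def K_def)
  have K: "add_subgroup K" by (auto simp: K_def add_subgroup_def distrib_left)
  have "perp U \<subseteq> perp K"
    unfolding P by (auto simp: perp_def K_def distrib_right)
  moreover have "perp K \<subseteq> perp U" using UK by (auto simp: perp_def)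
  ultimately have "perp K = perp U" by blast
  then have "card K = card U"
    using card_perp [OF K] card_perp [OF U(1)]
    by (metis mult_cancel1 mult_0 zero_less_card_finite less_irrefl)
  then have "U = K" using UK by (simp add: card_subset_eq)
  moreover have "y' = y + 1" using k1 y by (metis k_def double_left)
  ultimately show thesis using that a cc by (simp add: K_def)
qed

end

section \<open>Points and lines in coordinates\<close>

lemma vec_span_singleton: "vec.span {p} = range (\<lambda>k. k *s (p :: 'a::field ^ 'n))"
  by (rule vec.span_singleton)

lemma pg_points_iff: "P \<in> pg_points \<longleftrightarrow> (\<exists>p. p \<noteq> 0 \<and> P = vec.span {p})"
proof
  assume "P \<in> pg_points"
  then have P: "vec.subspace P" "vec.dim P = 1" by (auto simp: pg_points_def)
  obtain B where B: "B \<subseteq> P" "vec.independent B" "P \<subseteq> vec.span B" "card B = vec.dim P"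
    using vec.basis_exists [of P] by blast
  then obtain p where p: "B = {p}" using P by (auto simp: card_1_singleton_iff)
  have "vec.span B \<subseteq> P" using B P by (simp add: vec.span_minimal)
  then have "P = vec.span {p}" using B p by auto
  moreover have "p \<noteq> 0" using B p vec.dependent_zero [of "{p}"] by auto
  ultimately show "\<exists>p. p \<noteq> 0 \<and> P = vec.span {p}" by blast
next
  assume "\<exists>p. p \<noteq> 0 \<and> P = vec.span {p}"
  then show "P \<in> pg_points" by (auto simp: pg_points_def)
qed

lemma span_singleton_eq_iff:
  fixes p q :: "'a::field ^ 'n"
  assumes "p \<noteq> 0"
  shows "vec.span {p} = vec.span {q} \<longleftrightarrow> (\<exists>k. k \<noteq> 0 \<and> p = k *s q)"
proof
  assume "vec.span {p} = vec.span {q}"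
  then have "p \<in> vec.span {q}" using vec.span_base [of p "{p}"] by auto
  then obtain k where "p = k *s q" by (auto simp: vec_span_singleton)
  with assms show "\<exists>k. k \<noteq> 0 \<and> p = k *s q" by (intro exI [of _ k]) auto
next
  assume "\<exists>k. k \<noteq> 0 \<and> p = k *s q"
  then obtain k where k: "k \<noteq> 0" "p = k *s q" by blast
  then have "q = inverse k *s p" by simp
  then have "q \<in> vec.span {p}" by (metis rangeI vec_span_singleton)
  moreover have "p \<in> vec.span {q}" using k by (metis rangeI vec_span_singleton)
  ultimately show "vec.span {p} = vec.span {q}"
    by (simp add: vec.span_eq)
qed

lemma span_singleton_subset_iff:
  fixes p :: "'a::field ^ 'n"
  assumes "vec.subspace U"
  shows "vec.span {p} \<subseteq> U \<longleftrightarrow> p \<in> U"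
  using vec.span_minimal [of "{p}" U] assms vec.span_base [of p "{p}"] by blast

lemma span_pair_iff:
  fixes p q :: "'a::field ^ 'n"
  shows "r \<in> vec.span {p, q} \<longleftrightarrow> (\<exists>a b. r = a *s p + b *s q)"
proof -
  have "(r - a *s p = b *s q) = (r = a *s p + b *s q)" for a b
    by (simp add: diff_eq_eq add.commute)
  then show ?thesis by (simp add: vec.span_breakdown_eq [of r] vec_span_singleton image_iff)
qed

lemma pg_join_iff:
  assumes "r \<noteq> 0"
  shows "vec.span {r} \<in> pg_join (vec.span {p}) (vec.span {q}) \<longleftrightarrow> (\<exists>a b. r = a *s p + b *s q)"
proof -
  have "vec.span (vec.span {p} \<union> vec.span {q}) = vec.span ({p} \<union> {q})"
    by (simp only: vec.span_Un vec.span_span)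
  then have "vec.span (vec.span {p} \<union> vec.span {q}) = vec.span {p, q}"
    by (simp add: insert_commute)
  then show ?thesis
    using assms by (auto simp: pg_join_def pg_points_iff span_singleton_subset_iff span_pair_iff)
qed

lemma dim_span_pair:
  fixes p q :: "'a::field ^ 'n"
  assumes "p \<noteq> 0" "q \<noteq> 0" "vec.span {p} \<noteq> vec.span {q}"
  shows "vec.dim (vec.span {p, q}) = 2"
proof -
  have "p \<notin> vec.span {q}"
  proof
    assume "p \<in> vec.span {q}"
    then obtain k where "p = k *s q" by (auto simp: vec_span_singleton)
    then show False using assms span_singleton_eq_iff [of p q] by auto
  qed
  then show ?thesis using assms by (simp add: vec.dim_insert)
qed

lemma join_span:
  "pg_join (vec.span {p}) (vec.span {q}) = {P \<in> pg_points. P \<subseteq> vec.span {p, q}}"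
proof -
  have "vec.span (vec.span {p} \<union> vec.span {q}) = vec.span ({p} \<union> {q})"
    by (simp only: vec.span_Un vec.span_span)
  then have "vec.span (vec.span {p} \<union> vec.span {q}) = vec.span {p, q}"
    by (simp add: insert_commute)
  then show ?thesis by (simp add: pg_join_def)
qed

lemma pg_join_line:
  assumes "P \<in> pg_points" "Q \<in> pg_points" "P \<noteq> Q"
  shows "pg_join P Q \<in> pg_lines"
proof -
  obtain p q where pq: "p \<noteq> 0" "q \<noteq> 0" "P = vec.span {p}" "Q = vec.span {q}"
    using assms by (auto simp: pg_points_iff)
  then have "vec.dim (vec.span {p, q}) = 2" using assms dim_span_pair by metis
  then show ?thesis
    unfolding pg_lines_def pq(3,4) join_span by blast
qed

lemma pg_line_eq_join:
  assumes "L \<in> pg_lines" "P \<in> L" "Q \<in> L" "P \<noteq> Q"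
  shows "L = pg_join P Q"
proof -
  obtain U where U: "vec.subspace U" "vec.dim U = 2" "L = {P \<in> pg_points. P \<subseteq> U}"
    using assms by (auto simp: pg_lines_def)
  obtain p q where pq: "p \<noteq> 0" "q \<noteq> 0" "P = vec.span {p}" "Q = vec.span {q}"
    using assms U by (auto simp: pg_points_iff)
  have "vec.span {p, q} \<subseteq> U"
    using assms pq U by (intro vec.span_minimal) (auto simp: span_singleton_subset_iff)
  moreover have "vec.dim (vec.span {p, q}) = 2" using dim_span_pair pq assms by blast
  ultimately have "vec.span {p, q} = U"
    using U vec.subspace_dim_equal [of "vec.span {p, q}" U] by simp
  then show ?thesis using U by (simp add: pq join_span)
qed

lemma pg_line_subset_points: "L \<in> pg_lines \<Longrightarrow> L \<subseteq> pg_points"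
  by (auto simp: pg_lines_def)

lemma pg_line_second_point:
  assumes "L \<in> pg_lines" "P \<in> L"
  obtains Q where "Q \<in> L" "Q \<noteq> P"
proof -
  obtain U where U: "vec.subspace U" "vec.dim U = 2" "L = {P \<in> pg_points. P \<subseteq> U}"
    using assms by (auto simp: pg_lines_def)
  then have P: "vec.dim P = 1" using assms by (auto simp: pg_points_def)
  have "\<not> U \<subseteq> P" using vec.dim_subset [of U P] U P by auto
  then obtain q where q: "q \<in> U" "q \<notin> P" by blast
  have "0 \<in> P" using assms U by (auto simp: pg_points_def vec.subspace_0)
  with q have "q \<noteq> 0" by auto
  then have "vec.span {q} \<in> L" using q U by (auto simp: span_singleton_subset_iff pg_points_iff)
  moreover have "vec.span {q} \<noteq> P" using q vec.span_base [of q "{q}"] by auto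
  ultimately show thesis by (rule that)
qed

section \<open>Homogeneous coordinates with respect to the columns of a matrix\<close>

definition fpt :: "'a::field ^ 3 ^ 3 \<Rightarrow> 'a \<Rightarrow> 'a \<Rightarrow> 'a \<Rightarrow> 'a pg_point" where
  "fpt M x y z = vec.span {M *v vector [x, y, z]}"

lemma vector_3_eq_iff [simp]:
  "(vector [x, y, z] :: 'a::zero ^ 3) = vector [x', y', z'] \<longleftrightarrow> x = x' \<and> y = y' \<and> z = z'"
  by (auto simp: vec_eq_iff forall_3)

lemma vector_3_exhaust:
  obtains x y z where "v = (vector [x, y, z] :: 'a::zero ^ 3)"
  by (rule that [of "v $ 1" "v $ 2" "v $ 3"]) (simp add: vec_eq_iff forall_3)

lemma vector_3_eq_0_iff [simp]:
  "(vector [x, y, z] :: 'a::zero ^ 3) = 0 \<longleftrightarrow> x = 0 \<and> y = 0 \<and> z = 0"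
  by (auto simp: vec_eq_iff forall_3)

lemma vector_3_scale: "k *s (vector [x, y, z] :: 'a::field ^ 3) = vector [k * x, k * y, k * z]"
  by (auto simp: vec_eq_iff forall_3)

lemma vector_3_add:
  "(vector [x, y, z] :: 'a::field ^ 3) + vector [x', y', z'] = vector [x + x', y + y', z + z']"
  by (auto simp: vec_eq_iff forall_3)

lemma invertible_eq_iff:
  fixes M :: "'a::field ^ 'n ^ 'n"
  assumes "invertible M"
  shows "M *v u = M *v w \<longleftrightarrow> u = w"
  using assms by (metis invertible_def matrix_vector_mul_assoc matrix_vector_mul_lid)

lemma invertible_eq_0_iff:
  fixes M :: "'a::field ^ 'n ^ 'n"
  assumes "invertible M"
  shows "M *v u = 0 \<longleftrightarrow> u = 0"
  using invertible_eq_iff [OF assms, of u 0] by simp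

lemma fpt_eq_iff:
  assumes "invertible M" "(x, y, z) \<noteq> (0, 0, 0)"
  shows "fpt M x y z = fpt M x' y' z' \<longleftrightarrow> (\<exists>k. k \<noteq> 0 \<and> x = k * x' \<and> y = k * y' \<and> z = k * z')"
proof -
  have "M *v vector [x, y, z] \<noteq> 0" using assms by (simp add: invertible_eq_0_iff)
  then show ?thesis
    by (simp add: fpt_def span_singleton_eq_iff vector_scalar_commute [symmetric]
        invertible_eq_iff [OF assms(1)] vector_3_scale)
qed

lemma fpt_point: "invertible M \<Longrightarrow> (x, y, z) \<noteq> (0, 0, 0) \<Longrightarrow> fpt M x y z \<in> pg_points"
  by (auto simp: fpt_def pg_points_iff invertible_eq_0_iff intro!: exI [of _ "M *v vector [x, y, z]"])

lemma fpt_simps [simp]: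
  assumes "invertible M"
  shows "fpt M x y 1 = fpt M x' y' 1 \<longleftrightarrow> x = x' \<and> y = y'"
    and "fpt M x 1 0 = fpt M x' 1 0 \<longleftrightarrow> x = x'"
    and "fpt M x 1 0 \<noteq> fpt M x' y' 1" and "fpt M x' y' 1 \<noteq> fpt M x 1 0"
    and "fpt M 1 0 0 \<noteq> fpt M x y 1" and "fpt M x y 1 \<noteq> fpt M 1 0 0"
    and "fpt M 1 0 0 \<noteq> fpt M x 1 0" and "fpt M x 1 0 \<noteq> fpt M 1 0 0"
    and "fpt M x y 1 \<in> pg_points" and "fpt M x 1 0 \<in> pg_points" and "fpt M 1 0 0 \<in> pg_points"
  using assms by (auto simp: fpt_eq_iff fpt_point)

text \<open>Scaling the last nonzero coordinate to 1 gives the three kinds of points.\<close>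

lemma fpt_cases:
  assumes "invertible M" "P \<in> pg_points"
  obtains x y where "P = fpt M x y 1" | s where "P = fpt M s 1 0" | "P = fpt M 1 0 0"
proof -
  obtain p where p: "p \<noteq> 0" "P = vec.span {p}" using assms by (auto simp: pg_points_iff)
  obtain w where w: "M *v w = p"
    using assms(1) by (metis invertible_def matrix_vector_mul_assoc matrix_vector_mul_lid)
  obtain x y z where xyz: "w = vector [x, y, z]"
    by (rule vector_3_exhaust)
  have P: "P = fpt M x y z" using p w xyz by (simp add: fpt_def)
  have nz: "(x, y, z) \<noteq> (0, 0, 0)"
  proof
    assume "(x, y, z) = (0, 0, 0)"
    then have "w = 0" unfolding xyz by simp
    then show False using w p by simp
  qed
  consider "z \<noteq> 0" | "z = 0" "y \<noteq> 0" | "z = 0" "y = 0" "x \<noteq> 0" using nz by auto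
  then show thesis
  proof cases
    case 1
    then have "P = fpt M (x / z) (y / z) 1"
      unfolding P fpt_eq_iff [OF assms(1) nz] by (intro exI [of _ z]) simp
    then show thesis by (rule that)
  next
    case 2
    then have "P = fpt M (x / y) 1 0"
      unfolding P fpt_eq_iff [OF assms(1) nz] by (intro exI [of _ y]) simp
    then show thesis by (rule that)
  next
    case 3
    then have "P = fpt M 1 0 0"
      unfolding P fpt_eq_iff [OF assms(1) nz] by (intro exI [of _ x]) simp
    then show thesis by (rule that)
  qed
qed

lemma fpt_in_join:
  assumes M: "invertible M" and nz: "(x, y, z) \<noteq> (0, 0, 0)"
  shows "fpt M x y z \<in> pg_join (fpt M x1 y1 z1) (fpt M x2 y2 z2) \<longleftrightarrow>
    (\<exists>a b. x = a * x1 + b * x2 \<and> y = a * y1 + b * y2 \<and> z = a * z1 + b * z2)"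
proof -
  have nz: "M *v vector [x, y, z] \<noteq> 0" using nz M by (simp add: invertible_eq_0_iff)
  show ?thesis
    unfolding fpt_def pg_join_iff [OF nz]
    by (simp add: vector_scalar_commute [symmetric] matrix_vector_right_distrib [symmetric]
        invertible_eq_iff [OF M] vector_3_scale vector_3_add)
qed

section \<open>Frames with \<open>N\<close> as the point (1, 0, 0) and \<open>l\<close> as the line
  z = 0\<close>

definition adapted :: "'a::field ^ 3 ^ 3 \<Rightarrow> 'a pg_point \<Rightarrow> 'a pg_line \<Rightarrow> bool" where
  "adapted M N l \<longleftrightarrow> invertible M \<and> N = fpt M 1 0 0 \<and> l = insert N (range (\<lambda>s. fpt M s 1 0))"

text \<open>The columns are vectors of \<open>N\<close>, of a second point of \<open>l\<close>, and
  a vector outside the plane of \<open>l\<close>.\<close>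

lemma exists_adapted:
  assumes l: "l \<in> pg_lines" and N: "N \<in> l"
  obtains M where "adapted M N l"
proof -
  obtain Q where Q: "Q \<in> l" "Q \<noteq> N" using pg_line_second_point [OF assms] .
  have "N \<in> pg_points" "Q \<in> pg_points" using l N Q pg_line_subset_points by blast+
  then obtain n w where nw: "n \<noteq> 0" "w \<noteq> 0" "N = vec.span {n}" "Q = vec.span {w}"
    by (auto simp: pg_points_iff)
  have lj: "l = pg_join N Q" using pg_line_eq_join l N Q by blast
  have d2: "vec.dim (vec.span {n, w}) = 2" using dim_span_pair nw Q by metis
  have "vec.span {n, w} \<noteq> (UNIV :: ('a ^ 3) set)"
  proof
    assume "vec.span {n, w} = (UNIV :: ('a ^ 3) set)"
    then have "vec.dim (UNIV :: ('a ^ 3) set) = 2" using d2 by simp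
    then show False by (simp add: vec.dim_UNIV dimension_def card_cart_basis)
  qed
  then obtain r where r: "r \<notin> vec.span {n, w}" by blast
  define M :: "'a ^ 3 ^ 3" where "M = (\<chi> i. vector [n $ i, w $ i, r $ i])"
  have Mv: "M *v vector [x, y, z] = x *s n + y *s w + z *s r" for x y z
    by (simp add: vec_eq_iff M_def matrix_vector_mult_def sum_3 mult.commute)
  \<comment> \<open>Independence of the columns: a relation with \<open>z \<noteq> 0\<close> would
    put \<open>r\<close> into the span of \<open>n\<close> and \<open>w\<close>, and one with
    \<open>z = 0\<close> and \<open>y \<noteq> 0\<close> would identify \<open>Q\<close> with
    \<open>N\<close>.\<close>
  have "M *v v = 0 \<Longrightarrow> v = 0" for v
  proof -
    obtain x y z where v: "v = vector [x, y, z]" by (rule vector_3_exhaust)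
    assume "M *v v = 0"
    then have 0: "x *s n + y *s w + z *s r = 0" by (simp add: v Mv)
    have "z = 0"
    proof (rule ccontr)
      assume z: "z \<noteq> 0"
      have "z *s r = - (x *s n + y *s w)" using 0 by (metis add.commute eq_neg_iff_add_eq_0)
      then have "inverse z *s (z *s r) = inverse z *s (- (x *s n + y *s w))" by (rule arg_cong)
      then have "r = (- x / z) *s n + (- y / z) *s w"
        using z by (simp add: vec_eq_iff field_simps)
      then show False using r span_pair_iff by blast
    qed
    moreover have "y = 0"
    proof (rule ccontr)
      assume y: "y \<noteq> 0"
      have "y *s w = (- x) *s n" using 0 \<open>z = 0\<close> by (simp add: vec_eq_iff) (metis add.commute eq_neg_iff_add_eq_0)
      then have "inverse y *s (y *s w) = inverse y *s ((- x) *s n)" by (rule arg_cong)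
      then have w: "w = (- x / y) *s n" using y by (simp add: vec_eq_iff field_simps)
      then have "- x / y \<noteq> 0" using nw by auto
      then have "Q = N" unfolding nw span_singleton_eq_iff [OF nw(2)] using w by blast
      then show False using Q by simp
    qed
    ultimately show "v = 0" using 0 nw by (simp add: v)
  qed
  then have M: "invertible M"
    by (simp add: invertible_left_inverse matrix_left_invertible_ker)
  have fN: "N = fpt M 1 0 0" and fQ: "Q = fpt M 0 1 0" by (simp_all add: fpt_def Mv nw)
  have "l = insert N (range (\<lambda>s. fpt M s 1 0))"
  proof (intro set_eqI iffI)
    fix P assume P: "P \<in> l"
    then have "P \<in> pg_points" using l pg_line_subset_points by blast
    with M show "P \<in> insert N (range (\<lambda>s. fpt M s 1 0))"
    proof (cases rule: fpt_cases)
      case (1 x y)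
      then show ?thesis using P unfolding lj fN fQ by (simp add: fpt_in_join M)
    qed (auto simp: fN)
  next
    fix P assume "P \<in> insert N (range (\<lambda>s. fpt M s 1 0))"
    then show "P \<in> l" unfolding lj fN fQ by (auto simp: fpt_in_join M)
  qed
  then show thesis using that M fN by (simp add: adapted_def)
qed

lemma adapted_join:
  assumes "adapted M N l"
  shows "pg_join N (fpt M x y 1) = insert N (range (\<lambda>x. fpt M x y 1))"
proof -
  have M: "invertible M" and N: "N = fpt M 1 0 0" using assms by (auto simp: adapted_def)
  show ?thesis
  proof (intro set_eqI iffI)
    fix P assume P: "P \<in> pg_join N (fpt M x y 1)"
    then have "P \<in> pg_points" by (simp add: pg_join_def)
    with M show "P \<in> insert N (range (\<lambda>x. fpt M x y 1))"
    proof (cases rule: fpt_cases)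
      case (1 x' y')
      then show ?thesis using P unfolding N by (auto simp: fpt_in_join M)
    next
      case (2 s)
      then show ?thesis using P unfolding N by (auto simp: fpt_in_join M)
    qed (auto simp: N)
  next
    fix P assume "P \<in> insert N (range (\<lambda>x. fpt M x y 1))"
    moreover have "\<exists>a. x' = a + x" for x' by (rule exI [of _ "x' - x"]) simp
    ultimately show "P \<in> pg_join N (fpt M x y 1)"
      unfolding N by (auto simp: fpt_in_join M)
  qed
qed

lemma adapted_vertical_line:
  assumes "adapted M N l"
  shows "insert N (range (\<lambda>x. fpt M x y 1)) \<in> pg_lines"
  using pg_join_line [of N "fpt M 0 y 1"] assms
  by (simp add: adapted_join [OF assms]) (simp add: adapted_def)

text \<open>A second point of \<open>L\<close> decides: an affine one fixes the height
  \<open>y\<close>, and one on \<open>l\<close> would make \<open>L\<close> equal to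
  \<open>l\<close>.\<close>

lemma adapted_line_cases:
  assumes ad: "adapted M N l" and L: "L \<in> pg_lines" "N \<in> L" "L \<noteq> l" and l: "l \<in> pg_lines"
  obtains y where "L = insert N (range (\<lambda>x. fpt M x y 1))"
proof -
  have M: "invertible M" and N: "N = fpt M 1 0 0" and lM: "l = insert N (range (\<lambda>s. fpt M s 1 0))"
    using ad by (auto simp: adapted_def)
  obtain P where P: "P \<in> L" "P \<noteq> N" using pg_line_second_point [OF L(1,2)] .
  then have LP: "L = pg_join N P" using pg_line_eq_join L by blast
  have "P \<in> pg_points" using P L pg_line_subset_points by blast
  with M show thesis
  proof (cases rule: fpt_cases)
    case (1 x y)
    then show thesis using that [of y] LP by (simp add: adapted_join [OF ad])
  next
    case (2 s)
    then have "P \<in> l" "N \<in> l" using lM by auto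
    then have "l = pg_join N P" using pg_line_eq_join P l by blast
    then show thesis using LP L by simp
  next
    case 3
    then show thesis using P N by simp
  qed
qed

text \<open>A combination of the two coordinate vectors has last coordinate 0 only for opposite
  coefficients, so the join meets \<open>l\<close> in the point given by their difference.\<close>

lemma adapted_join_Int:
  assumes ad: "adapted M N l" and y: "y \<noteq> y'"
  shows "pg_join (fpt M x y 1) (fpt M x' y' 1) \<inter> l = {fpt M ((x - x') / (y - y')) 1 0}"
proof -
  have M: "invertible M" and N: "N = fpt M 1 0 0" and l: "l = insert N (range (\<lambda>s. fpt M s 1 0))"
    using ad by (auto simp: adapted_def)
  have "N \<notin> pg_join (fpt M x y 1) (fpt M x' y' 1)"
  proof
    assume "N \<in> pg_join (fpt M x y 1) (fpt M x' y' 1)"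
    then obtain a b where *: "1 = a * x + b * x'" "0 = a * y + b * y'" "0 = a + b"
      unfolding N by (auto simp: fpt_in_join M)
    then have b: "b = - a" by (metis add_eq_0_iff)
    then have "a * y = a * y'" using * by simp
    then have "a = 0" using y by simp
    then show False using b * by simp
  qed
  moreover have "fpt M s 1 0 \<in> pg_join (fpt M x y 1) (fpt M x' y' 1) \<longleftrightarrow> s = (x - x') / (y - y')" for s
  proof
    assume "fpt M s 1 0 \<in> pg_join (fpt M x y 1) (fpt M x' y' 1)"
    then obtain a b where *: "s = a * x + b * x'" "1 = a * y + b * y'" "0 = a + b"
      by (auto simp: fpt_in_join M)
    then have b: "b = - a" by (metis add_eq_0_iff)
    then have 1: "a * (y - y') = 1" and s: "s = a * (x - x')" using * by (simp_all add: algebra_simps)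
    have "s * (y - y') = a * (y - y') * (x - x')" by (simp add: s)
    then have "s * (y - y') = x - x'" by (simp only: 1 mult_1)
    then show "s = (x - x') / (y - y')" using y by (simp add: eq_divide_eq)
  next
    assume s: "s = (x - x') / (y - y')"
    show "fpt M s 1 0 \<in> pg_join (fpt M x y 1) (fpt M x' y' 1)"
      using M s y by (simp add: fpt_in_join)
        (intro exI [of _ "1 / (y - y')"] exI [of _ "- (1 / (y - y'))"],
          simp add: diff_divide_distrib [symmetric])
  qed
  ultimately show ?thesis unfolding l by auto
qed

section \<open>Clubs in coordinates\<close>

context binary_field
begin

lemma vec_diff_eq: "v - w = v + (w :: 'a ^ 'n)"
  by (simp add: vec_eq_iff)

lemma f2_subspace_iff:
  "f2_subspace (W :: ('a ^ 'n) set) \<longleftrightarrow> 0 \<in> W \<and> (\<forall>v\<in>W. \<forall>w\<in>W. v + w \<in> W)"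
proof -
  interpret f2: vector_space "f2_scale :: bit \<Rightarrow> 'a ^ 'n \<Rightarrow> 'a ^ 'n"
    using vector_space_f2_scale double by blast
  show ?thesis by (auto simp: f2.subspace_def f2_scale_def)
qed

text \<open>Induction on a basis: a new basis vector adds to the span one disjoint coset of the same
  size.\<close>

lemma card_f2_subspace:
  fixes W :: "('a ^ 'n) set"
  assumes W: "f2_subspace W"
  shows "card W = 2 ^ f2_dim W"
proof -
  interpret f2: vector_space "f2_scale :: bit \<Rightarrow> 'a ^ 'n \<Rightarrow> 'a ^ 'n"
    using vector_space_f2_scale double by blast
  have span: "card (f2.span B) = 2 ^ card B" if "finite B" "f2.independent B" for B
    using that
  proof induction
    case (insert b B)
    then have b: "b \<notin> f2.span B" and ind: "f2.independent B" by (auto simp: f2.independent_insert)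
    have "(\<exists>k. P (f2_scale k b)) \<longleftrightarrow> P (f2_scale 0 b) \<or> P (f2_scale 1 b)" for P
      by (metis bit_not_one_iff)
    then have ex: "(\<exists>k. P (f2_scale k b)) \<longleftrightarrow> P 0 \<or> P b" for P
      by (simp add: f2_scale_def)
    have "f2.span (insert b B) = f2.span B \<union> (+) b ` f2.span B"
    proof (intro set_eqI)
      fix x
      have "x + b \<in> f2.span B \<longleftrightarrow> x \<in> (+) b ` f2.span B"
      proof
        assume "x + b \<in> f2.span B"
        moreover have "x = b + (x + b)" by (simp add: vec_eq_iff add_ac)
        ultimately show "x \<in> (+) b ` f2.span B" by (rule image_eqI [rotated])
      next
        assume "x \<in> (+) b ` f2.span B"
        then obtain y where "y \<in> f2.span B" "x = b + y" by blast
        moreover have "b + y + b = y" for y by (simp add: vec_eq_iff add_ac)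
        ultimately show "x + b \<in> f2.span B" by simp
      qed
      then show "x \<in> f2.span (insert b B) \<longleftrightarrow> x \<in> f2.span B \<union> (+) b ` f2.span B"
        by (simp add: f2.span_breakdown_eq [of x] ex [of "\<lambda>w. x + w \<in> f2.span B"] vec_diff_eq)
    qed
    moreover have "f2.span B \<inter> (+) b ` f2.span B = {}"
    proof -
      have False if "y \<in> f2.span B" "b + y \<in> f2.span B" for y
      proof -
        have "b + y + y \<in> f2.span B" using that f2.span_add by blast
        moreover have "b + y + y = b" by (simp add: vec_eq_iff add.assoc)
        ultimately show False using b by simp
      qed
      then show ?thesis by blast
    qed
    ultimately have "card (f2.span (insert b B)) = card (f2.span B) + card ((+) b ` f2.span B)"
      by (simp add: card_Un_disjoint)
    also have "\<dots> = 2 * card (f2.span B)" by (simp add: card_image)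
    finally show ?case using insert ind by simp
  qed simp
  obtain B where B: "B \<subseteq> W" "f2.independent B" "W \<subseteq> f2.span B" "card B = f2.dim W"
    using f2.basis_exists by blast
  then have "f2.span B = W" using W f2.span_minimal by blast
  then show ?thesis using span [OF _ B(2)] B by simp
qed

text \<open>The case \<open>h = 1\<close> is excluded because 4 divides q, so neither exponent is a
  truncated difference.\<close>

lemma quarter_powers:
  assumes "4 * t = CARD('a)"
  shows "(2::nat) ^ (h - 1) = 2 * t" "(2::nat) ^ (h - 2) = t" "0 < t"
proof -
  show t: "0 < t" using assms by (metis mult_0_right neq0_conv zero_less_card_finite less_irrefl)
  have "h \<noteq> 1"
  proof
    assume "h = 1"
    then have "4 * t = 2" using assms card_field by simp
    then show False by presburger
  qed
  then obtain k where k: "h = Suc (Suc k)" using h_pos by (metis One_nat_def not0_implies_Suc not_gr_zero)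
  show "(2::nat) ^ (h - 1) = 2 * t" "(2::nat) ^ (h - 2) = t"
    using assms card_field by (simp_all add: k)
qed

text \<open>The subspace behind the club has \<open>2 * t\<close> vectors, \<open>t\<close> of them
  in the head, so it consists of the head part and one further coset. Only that coset yields points
  other than \<open>N\<close>; their parameters form a coset of an additive group of order
  \<open>t\<close>, which closure under sums of three expresses without naming a
  representative.\<close>

lemma club_coordinates:
  fixes M :: "'a ^ 3 ^ 3"
  assumes ad: "adapted M N l" and t: "4 * t = CARD('a)"
    and club: "f2_club_with_head (h - 2) (h - 1) l N (D \<union> {N})"
  shows "card {s. fpt M s 1 0 \<in> D} = t"
    and "fpt M r 1 0 \<in> D \<Longrightarrow> fpt M s 1 0 \<in> D \<Longrightarrow> fpt M u 1 0 \<in> D \<Longrightarrow> fpt M (r + s + u) 1 0 \<in> D"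
proof -
  have M: "invertible M" and N: "N = fpt M 1 0 0" and l: "l = insert N (range (\<lambda>s. fpt M s 1 0))"
    using ad by (auto simp: adapted_def)
  obtain W where W: "f2_subspace W" "W \<subseteq> \<Union>l" "f2_dim W = h - 1" "D \<union> {N} = points_of W"
      "f2_weight W N = h - 2"
    using club by (auto simp: f2_club_with_head_def)
  \<comment> \<open>\<open>g\<close> identifies pairs \<open>(x, y)\<close> with the vectors of the
    plane underlying \<open>l\<close>; the head \<open>N\<close> is given by
    \<open>y = 0\<close>.\<close>
  define g where "g = (\<lambda>(x, y). M *v vector [x, y, 0])"
  have g_inj: "inj g" by (auto simp: g_def inj_def invertible_eq_iff [OF M])
  have g_add: "g (x + x', y + y') = g (x, y) + g (x', y')" for x x' y y'
    by (simp add: g_def matrix_vector_right_distrib [symmetric] vector_3_add)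
  define V where "V = g -` W"
  have V_add: "(x + x', y + y') \<in> V" if "(x, y) \<in> V" "(x', y') \<in> V" for x x' y y'
    using that W(1) by (simp add: V_def g_add f2_subspace_iff)
  have Wg: "W \<subseteq> range g"
  proof
    fix w assume "w \<in> W"
    then obtain P where "P \<in> l" "w \<in> P" using W by blast
    then obtain x y where "w \<in> vec.span {M *v vector [x, y, 0]}"
      unfolding l N fpt_def by blast
    then obtain k where "w = k *s (M *v vector [x, y, 0])" by (auto simp: vec_span_singleton)
    then have "w = g (k * x, k * y)"
      by (simp add: g_def vector_scalar_commute [symmetric] vector_3_scale)
    then show "w \<in> range g" by blast
  qed
  then have gV: "g ` V = W" by (auto simp: V_def)
  define V0 where "V0 = {x. (x, 0) \<in> V}"
  have NW: "(\<lambda>x. g (x, 0)) ` V0 = W \<inter> N"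
  proof (intro set_eqI iffI)
    fix w assume "w \<in> (\<lambda>x. g (x, 0)) ` V0"
    then obtain x where x: "(x, 0) \<in> V" "w = g (x, 0)" by (auto simp: V0_def)
    have "g (x, 0) = x *s (M *v vector [1, 0, 0])"
      by (simp add: g_def vector_scalar_commute [symmetric] vector_3_scale)
    then show "w \<in> W \<inter> N" using x unfolding N fpt_def vec_span_singleton V_def by auto
  next
    fix w assume w: "w \<in> W \<inter> N"
    then obtain k where "w = k *s (M *v vector [1, 0, 0])"
      unfolding N fpt_def vec_span_singleton by blast
    then have "w = g (k, 0)"
      by (simp add: g_def vector_scalar_commute [symmetric] vector_3_scale)
    then show "w \<in> (\<lambda>x. g (x, 0)) ` V0" using w by (auto simp: V0_def V_def)
  qed
  have "card W = 2 * t" using card_f2_subspace [OF W(1)] W(3) quarter_powers [OF t] by simp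
  moreover have "card (g ` V) = card V" using g_inj by (intro card_image) (auto intro: inj_on_subset)
  ultimately have cV: "card V = 2 * t" unfolding gV by simp
  have "f2_subspace (W \<inter> N)"
    using W(1) unfolding f2_subspace_iff N fpt_def by (auto intro: vec.span_add vec.span_zero)
  then have "card (W \<inter> N) = t"
    using card_f2_subspace [of "W \<inter> N"] W(5) quarter_powers [OF t] by (simp add: f2_weight_def)
  moreover have "card ((\<lambda>x. g (x, 0)) ` V0) = card V0"
    using g_inj by (intro card_image) (auto simp: inj_on_def)
  ultimately have cV0: "card V0 = t" unfolding NW by simp
  have V0_add: "x + x' \<in> V0" if "x \<in> V0" "x' \<in> V0" for x x'
    using V_add [of x 0 x' 0] that by (simp add: V0_def)
  \<comment> \<open>By size, \<open>V\<close> has an element with nonzero second coordinate; it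
    represents the other coset of \<open>V0\<close>.\<close>
  have "\<not> V \<subseteq> (\<lambda>x. (x, 0)) ` V0"
  proof
    assume "V \<subseteq> (\<lambda>x. (x, 0)) ` V0"
    then have "card V \<le> card V0" by (rule surj_card_le [rotated]) simp
    then show False using cV cV0 quarter_powers [OF t] by simp
  qed
  then obtain x0 y0 where xy0: "(x0, y0) \<in> V" "(x0, y0) \<notin> (\<lambda>x. (x, 0)) ` V0" by auto
  then have y0: "y0 \<noteq> 0" by (auto simp: V0_def)
  have V: "V = (\<lambda>x. (x, 0)) ` V0 \<union> (\<lambda>x. (x0 + x, y0)) ` V0" (is "V = ?A \<union> ?B")
  proof (rule card_subset_eq [symmetric])
    show "?A \<union> ?B \<subseteq> V" using V_add [OF xy0(1)] by (force simp: V0_def)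
    have "card ?A = card V0" "card ?B = card V0"
      by (auto intro!: card_image simp: inj_on_def)
    then show "card (?A \<union> ?B) = card V"
      using y0 cV cV0 by (subst card_Un_disjoint) auto
  qed simp
  have T: "fpt M s 1 0 \<in> D \<longleftrightarrow> s \<in> (\<lambda>x. (x0 + x) / y0) ` V0" for s
  proof -
    have "fpt M s 1 0 \<in> D \<longleftrightarrow> fpt M s 1 0 \<in> points_of W"
      using M by (simp add: W(4) [symmetric] N)
    also have "\<dots> \<longleftrightarrow> (\<exists>(x, y)\<in>V. (x, y, 0::'a) \<noteq> (0, 0, 0) \<and> fpt M s 1 0 = fpt M x y 0)"
      unfolding points_of_def gV [symmetric]
      using invertible_eq_0_iff [OF M]
      by (auto simp: g_def fpt_def split: prod.splits) force+
    also have "\<dots> \<longleftrightarrow> (\<exists>(x, y)\<in>V. y \<noteq> 0 \<and> s = x / y)"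
    proof -
      have "(x, y, 0::'a) \<noteq> (0, 0, 0) \<and> fpt M s 1 0 = fpt M x y 0 \<longleftrightarrow> y \<noteq> 0 \<and> s = x / y" for x y
      proof -
        have "fpt M s 1 0 = fpt M x y 0 \<longleftrightarrow> (\<exists>k. k \<noteq> 0 \<and> s = k * x \<and> 1 = k * y)"
          using fpt_eq_iff [OF M, of s 1 0 x y 0] by simp
        also have "\<dots> \<longleftrightarrow> y \<noteq> 0 \<and> s = x / y"
        proof
          assume "\<exists>k. k \<noteq> 0 \<and> s = k * x \<and> 1 = k * y"
          then obtain k where "s = k * x" "1 = k * y" by blast
          then have "y \<noteq> 0" "s * y = x" by (auto simp: mult.commute mult.left_commute)
          then show "y \<noteq> 0 \<and> s = x / y" by (simp add: eq_divide_eq)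
        qed (auto intro: exI [of _ "1 / y"])
        finally show ?thesis by auto
      qed
      then show ?thesis by simp
    qed
    also have "\<dots> \<longleftrightarrow> s \<in> (\<lambda>x. (x0 + x) / y0) ` V0"
      unfolding V using y0 by auto
    finally show ?thesis .
  qed
  have "card ((\<lambda>x. (x0 + x) / y0) ` V0) = t"
    using y0 cV0 by (subst card_image) (auto simp: inj_on_def)
  then show "card {s. fpt M s 1 0 \<in> D} = t" by (simp add: T)
  show "fpt M (r + s + u) 1 0 \<in> D" if "fpt M r 1 0 \<in> D" "fpt M s 1 0 \<in> D" "fpt M u 1 0 \<in> D"
  proof -
    from that obtain x y z where *: "x \<in> V0" "y \<in> V0" "z \<in> V0"
      "r = (x0 + x) / y0" "s = (x0 + y) / y0" "u = (x0 + z) / y0"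
      unfolding T by blast
    \<comment> \<open>Three copies of \<open>x0\<close> add up to \<open>x0\<close>.\<close>
    have "r + s + u = (x0 + (x + y + z)) / y0"
      unfolding * by (simp only: add_divide_distrib [symmetric]) (simp add: add_ac)
    then show ?thesis unfolding T using * V0_add by blast
  qed
qed

end

section \<open>Counting points on secants\<close>

definition upper_tri :: "'a::field \<Rightarrow> 'a \<Rightarrow> 'a \<Rightarrow> 'a \<Rightarrow> 'a \<Rightarrow> 'a ^ 3 ^ 3" where
  "upper_tri k m n r s = vector [vector [k, m, n], vector [0, r, s], vector [0, 0, 1]]"

lemma upper_tri_mult:
  "upper_tri k m n r s *v vector [x, y, z] = vector [k * x + m * y + n * z, r * y + s * z, z]"
  by (simp add: vec_eq_iff forall_3 upper_tri_def matrix_vector_mult_def sum_3)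

lemma invertible_upper_tri:
  assumes "k \<noteq> 0" "r \<noteq> 0"
  shows "invertible (upper_tri k m n r s)"
proof -
  have "v = 0" if "upper_tri k m n r s *v v = 0" for v
  proof -
    obtain x y z where v: "v = vector [x, y, z]" by (rule vector_3_exhaust)
    show ?thesis using that assms by (auto simp: v upper_tri_mult)
  qed
  then show ?thesis by (simp add: invertible_left_inverse matrix_left_invertible_ker)
qed

lemma fpt_upper_tri:
  "fpt (M ** upper_tri k m n r s) x y z = fpt M (k * x + m * y + n * z) (r * y + s * z) z"
  by (simp add: fpt_def matrix_vector_mul_assoc [symmetric] upper_tri_mult)

lemma adapted_upper_tri:
  assumes ad: "adapted M N l" and k: "k \<noteq> 0" "r \<noteq> 0"
  shows "adapted (M ** upper_tri k m n r s) N l"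
proof -
  have M: "invertible M" and N: "N = fpt M 1 0 0" and l: "l = insert N (range (\<lambda>s. fpt M s 1 0))"
    using ad by (auto simp: adapted_def)
  have 1: "invertible (M ** upper_tri k m n r s)"
    using M invertible_upper_tri [OF k] by (rule invertible_mult)
  \<comment> \<open>On \<open>l\<close> the change of frame acts as an invertible affine map of the
    parameter.\<close>
  have "fpt M (k * x + m) r 0 = fpt M ((k * x + m) / r) 1 0" for x
    using k fpt_eq_iff [OF M, of "k * x + m" r 0] by (auto intro!: exI [of _ r])
  moreover have "range (\<lambda>x. (k * x + m) / r) = UNIV"
  proof (intro surjI [of _ "\<lambda>x. (r * x - m) / k"])
    fix x show "(k * ((r * x - m) / k) + m) / r = x" using k by simp
  qed
  then have "(\<lambda>s. fpt M s 1 0) ` range (\<lambda>x. (k * x + m) / r) = range (\<lambda>s. fpt M s 1 0)"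
    by (rule arg_cong)
  then have "range (\<lambda>x. fpt M ((k * x + m) / r) 1 0) = range (\<lambda>s. fpt M s 1 0)"
    by (simp only: image_image)
  moreover have "fpt M k 0 0 = fpt M 1 0 0"
    using k fpt_eq_iff [OF M, of k 0 0] by (auto intro!: exI [of _ k])
  ultimately show ?thesis
    using 1 unfolding adapted_def by (simp add: fpt_upper_tri N l)
qed

context binary_field
begin

lemma adapted_dir_set:
  fixes M :: "'a ^ 3 ^ 3"
  assumes ad: "adapted M N l" and vw: "v \<noteq> w"
    and S: "S = (\<lambda>x. fpt M x v 1) ` X" and T: "T = (\<lambda>x. fpt M x w 1) ` Y"
  shows "dir_set l S T = {fpt M ((x + x') / (v + w)) 1 0 | x x'. x \<in> X \<and> x' \<in> Y}"
proof -
  have "pg_join (fpt M x v 1) (fpt M x' w 1) \<inter> l = {fpt M ((x + x') / (v + w)) 1 0}" for x x'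
    using adapted_join_Int [OF ad vw] by simp
  then show ?thesis unfolding dir_set_def S T by simp blast
qed

section \<open>Point counts for a KM-arc on the lines through the common point of its
  secants\<close>

context
  fixes M :: "'a ^ 3 ^ 3" and N l A t and L :: "nat \<Rightarrow> 'a pg_line"
  assumes ad: "adapted M N l" and t: "4 * t = CARD('a)" and km: "km_arc t A"
    and L: "bij_betw L {0..4} (secants t A)" and L0: "L 0 = l"
    and NL: "\<And>i. i \<in> {0..4} \<Longrightarrow> N \<in> L i"
begin

private lemma M: "invertible M" and N: "N = fpt M 1 0 0"
  and l: "l = insert N (range (\<lambda>s. fpt M s 1 0))"
  using ad by (auto simp: adapted_def)

private definition vert :: "'a \<Rightarrow> 'a pg_line" where
  "vert y = insert N (range (\<lambda>x. fpt M x y 1))"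

private lemma secant_line: "i \<in> {0..4} \<Longrightarrow> L i \<in> pg_lines" "i \<in> {0..4} \<Longrightarrow> card (A \<inter> L i) = t"
  using L by (auto simp: bij_betw_def secants_def)

lemma secant_vertical:
  assumes "i \<in> {1..4}"
  shows "\<exists>y. L i = insert N (range (\<lambda>x. fpt M x y 1))"
proof -
  have i: "i \<in> {0..4}" "i \<noteq> 0" using assms by auto
  have "L i \<noteq> L 0"
    using L i unfolding bij_betw_def inj_on_def by (metis atLeastAtMost_iff le0)
  then have "L i \<noteq> l" using L0 by simp
  moreover have "l \<in> pg_lines" using secant_line(1) [of 0] L0 by simp
  ultimately show ?thesis using adapted_line_cases [OF ad] secant_line(1) NL i by metis
qed

lemma secant_eq_vertical:
  assumes "i \<in> {1..4}" "fpt M x y 1 \<in> L i"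
  shows "L i = insert N (range (\<lambda>x. fpt M x y 1))"
  using secant_vertical [OF assms(1)] assms(2) M N by auto

private lemma inj_vert: "inj_on (\<lambda>x. fpt M x y 1) X"
  using M by (simp add: inj_on_def)

private lemma card_vert:
  "card (A \<inter> vert y) = card (A \<inter> {N}) + card {x. fpt M x y 1 \<in> A}"
proof -
  have "A \<inter> vert y = (A \<inter> {N}) \<union> (\<lambda>x. fpt M x y 1) ` {x. fpt M x y 1 \<in> A}"
    by (auto simp: vert_def)
  then show ?thesis
    using M by (simp, subst card_Un_disjoint) (auto simp: card_image [OF inj_vert] N)
qed

private lemma card_l:
  "t = card (A \<inter> {N}) + card {s. fpt M s 1 0 \<in> A}"
proof -
  have "A \<inter> l = (A \<inter> {N}) \<union> (\<lambda>s. fpt M s 1 0) ` {s. fpt M s 1 0 \<in> A}"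
    by (auto simp: l)
  then have "card (A \<inter> l) = card (A \<inter> {N}) + card {s. fpt M s 1 0 \<in> A}"
    using M by (simp, subst card_Un_disjoint) (auto simp: N card_image inj_on_def)
  then show ?thesis using secant_line(2) [of 0] L0 by simp
qed

text \<open>Here \<open>5 * t\<close> is q + t. The points split into \<open>N\<close>, the other
  points of \<open>l\<close>, and the affine points sorted by height.\<close>

private lemma card_A:
  "5 * t = card (A \<inter> {N}) + card {s. fpt M s 1 0 \<in> A} + (\<Sum>y\<in>UNIV. card {x. fpt M x y 1 \<in> A})"
proof -
  define B where "B = (SIGMA y:UNIV. {x. fpt M x y 1 \<in> A})"
  have "A \<subseteq> pg_points" using km by (simp add: km_arc_def)
  then have "A \<subseteq> ((A \<inter> {N}) \<union> (\<lambda>s. fpt M s 1 0) ` {s. fpt M s 1 0 \<in> A}) \<union> (\<lambda>(y, x). fpt M x y 1) ` B"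
  proof (intro subsetI)
    fix P assume P: "P \<in> A" "A \<subseteq> pg_points"
    then have "P \<in> pg_points" by blast
    with M show "P \<in> ((A \<inter> {N}) \<union> (\<lambda>s. fpt M s 1 0) ` {s. fpt M s 1 0 \<in> A}) \<union> (\<lambda>(y, x). fpt M x y 1) ` B"
      by (cases rule: fpt_cases) (use P(1) in \<open>auto simp: N B_def\<close>)
  qed
  then have "A = ((A \<inter> {N}) \<union> (\<lambda>s. fpt M s 1 0) ` {s. fpt M s 1 0 \<in> A}) \<union> (\<lambda>(y, x). fpt M x y 1) ` B"
    by (auto simp: B_def)
  then have "card A = card (((A \<inter> {N}) \<union> (\<lambda>s. fpt M s 1 0) ` {s. fpt M s 1 0 \<in> A}) \<union> (\<lambda>(y, x). fpt M x y 1) ` B)"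
    by (rule arg_cong)
  also have "\<dots> = card (A \<inter> {N}) + card ((\<lambda>s. fpt M s 1 0) ` {s. fpt M s 1 0 \<in> A}) + card ((\<lambda>(y, x). fpt M x y 1) ` B)"
    using M by (subst card_Un_disjoint, simp, simp, force simp: N, subst card_Un_disjoint) (auto simp: N)
  also have "card ((\<lambda>s. fpt M s 1 0) ` {s. fpt M s 1 0 \<in> A}) = card {s. fpt M s 1 0 \<in> A}"
    using M by (intro card_image) (simp add: inj_on_def)
  also have "card ((\<lambda>(y, x). fpt M x y 1) ` B) = card B"
    using M by (intro card_image) (auto simp: inj_on_def)
  also have "card B = (\<Sum>y\<in>UNIV. card {x. fpt M x y 1 \<in> A})"
    by (simp add: B_def)
  finally show ?thesis using km t by (simp add: km_arc_def)
qed

private definition Y where "Y = {y. vert y \<in> secants t A}"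

private lemma card_Y: "card Y = 4"
proof -
  have "vert ` Y = L ` {1..4}"
  proof (intro set_eqI iffI)
    fix m assume "m \<in> vert ` Y"
    then obtain y where y: "m = vert y" "m \<in> secants t A" by (auto simp: Y_def)
    then obtain i where i: "i \<in> {0..4}" "m = L i" using L unfolding bij_betw_def by blast
    moreover have "fpt M 0 y 1 \<in> vert y" by (simp add: vert_def)
    moreover have "fpt M 0 y 1 \<notin> l" using M by (auto simp: l N)
    ultimately have "i \<noteq> 0" using y L0 by metis
    then show "m \<in> L ` {1..4}" using i by auto
  next
    fix m assume "m \<in> L ` {1..4}"
    then obtain i where i: "i \<in> {1..4}" "m = L i" by auto
    moreover have "L i \<in> secants t A" using L i by (auto simp: bij_betw_def)
    ultimately show "m \<in> vert ` Y" using secant_vertical [of i] by (auto simp: Y_def vert_def)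
  qed
  moreover have "card (vert ` Y) = card Y"
  proof (intro card_image inj_onI)
    fix y z assume "vert y = vert z"
    then have "fpt M 0 y 1 \<in> vert z" by (auto simp: vert_def)
    then show "y = z" unfolding vert_def using M by (auto simp: N)
  qed
  moreover have "card (L ` {1..4}) = 4"
    using L by (subst card_image) (auto simp: bij_betw_def intro: inj_on_subset)
  ultimately show ?thesis by simp
qed

private lemma vert_line: "vert y \<in> pg_lines"
  using adapted_vertical_line [OF ad] by (simp add: vert_def)

private lemma card_vert_Y: "y \<in> Y \<Longrightarrow> card (A \<inter> vert y) = t"
  by (simp add: Y_def secants_def)

private lemma card_vert_not_Y: "y \<notin> Y \<Longrightarrow> card (A \<inter> vert y) \<in> {0, 2} - {t}"
  using km vert_line [of y] by (auto simp: Y_def secants_def km_arc_def)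

private lemma sum_vert_Y: "(\<Sum>y\<in>Y. card (A \<inter> vert y)) = 4 * t"
  using card_Y by (simp add: card_vert_Y)

private lemma card_compl_Y: "card (- Y) = 4 * t - 4"
  using card_Y t by (simp add: Compl_eq_Diff_UNIV card_Diff_subset)

text \<open>If \<open>N\<close> were in \<open>A\<close>, every line through \<open>N\<close> that
  is not a \<open>t\<close>-secant would meet \<open>A\<close> in exactly two points. Counting the
  affine points along all lines through \<open>N\<close> other than \<open>l\<close> then forces
  \<open>t = 2\<close>, which is ruled out separately.\<close>

lemma nucleus_notin: "N \<notin> A"
proof
  assume NA: "N \<in> A"
  then have e: "card (A \<inter> {N}) = 1" by simp
  have 2: "card (A \<inter> vert y) = 2" "t \<noteq> 2" if "y \<notin> Y" for y
  proof -
    have "N \<in> A \<inter> vert y" using NA by (simp add: vert_def)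
    then have "card (A \<inter> vert y) \<noteq> 0" by (metis card_0_eq emptyE finite)
    then show "card (A \<inter> vert y) = 2" "t \<noteq> 2" using card_vert_not_Y [OF that] by auto
  qed
  \<comment> \<open>For \<open>t = 2\<close> there are heights outside \<open>Y\<close>, and their
    lines, having two points, would be \<open>t\<close>-secants.\<close>
  have tt: "t \<noteq> 2"
  proof
    assume "t = 2"
    then have "card (- Y) \<noteq> 0" using card_compl_Y by simp
    then have "- Y \<noteq> {}" by auto
    then show False using 2 \<open>t = 2\<close> by auto
  qed
  have "(\<Sum>y\<in>UNIV. card (A \<inter> vert y)) = (\<Sum>y\<in>Y. card (A \<inter> vert y)) + (\<Sum>y\<in>-Y. card (A \<inter> vert y))"
    by (subst sum.union_disjoint [symmetric]) auto
  also have "\<dots> = 4 * t + 2 * (4 * t - 4)"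
    using 2 by (simp add: sum_vert_Y card_compl_Y)
  finally have "(\<Sum>y\<in>UNIV. card {x. fpt M x y 1 \<in> A}) + 4 * t = 4 * t + 2 * (4 * t - 4)"
    by (simp add: card_vert e sum_Suc t)
  moreover have "(\<Sum>y\<in>UNIV. card {x. fpt M x y 1 \<in> A}) = 4 * t" using card_A card_l by simp
  \<comment> \<open>Since \<open>Y\<close> has four elements, this ensures that
    \<open>4 * t - 4\<close> is not truncated.\<close>
  moreover have "card Y \<le> CARD('a)" by (rule card_mono) auto
  ultimately show False using tt t card_Y by simp
qed

lemma secant_coords:
  assumes "i \<in> {1..4}" "L i = insert N (range (\<lambda>x. fpt M x y 1))"
  shows "card {x. fpt M x y 1 \<in> A} = t"
    and "L i \<inter> A = (\<lambda>x. fpt M x y 1) ` {x. fpt M x y 1 \<in> A}"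
proof -
  show "card {x. fpt M x y 1 \<in> A} = t"
    using secant_line(2) [of i] assms card_vert [of y] nucleus_notin by (simp add: vert_def)
  show "L i \<inter> A = (\<lambda>x. fpt M x y 1) ` {x. fpt M x y 1 \<in> A}"
    using assms nucleus_notin by auto
qed

lemma card_axis: "card {s. fpt M s 1 0 \<in> A} = t"
  using card_l nucleus_notin by simp

text \<open>The four secants other than \<open>l\<close> already account for all
  \<open>4 * t\<close> affine points of \<open>A\<close>.\<close>

lemma affine_point_in_secant:
  assumes "fpt M x y 1 \<in> A"
  shows "\<exists>i\<in>{1..4}. fpt M x y 1 \<in> L i"
proof -
  have "(\<Sum>y\<in>UNIV. card (A \<inter> vert y)) = (\<Sum>y\<in>Y. card (A \<inter> vert y)) + (\<Sum>y\<in>-Y. card (A \<inter> vert y))"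
    by (subst sum.union_disjoint [symmetric]) auto
  moreover have "(\<Sum>y\<in>UNIV. card (A \<inter> vert y)) = 4 * t"
    using card_A card_l nucleus_notin by (simp add: card_vert)
  ultimately have "(\<Sum>y\<in>-Y. card (A \<inter> vert y)) = 0" using sum_vert_Y by simp
  then have "A \<inter> vert y = {}" if "y \<notin> Y" using that by auto
  moreover have "fpt M x y 1 \<in> A \<inter> vert y" using assms by (simp add: vert_def)
  ultimately have "y \<in> Y" by blast
  then obtain i where i: "i \<in> {0..4}" "vert y = L i" using L unfolding bij_betw_def Y_def by blast
  then have *: "fpt M x y 1 \<in> L i" by (auto simp: vert_def)
  moreover have "fpt M x y 1 \<notin> l" using M by (auto simp: l N)
  ultimately have "i \<noteq> 0" using L0 by metis
  then show ?thesis using i(1) * by (intro bexI [of _ i]) auto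
qed

text \<open>A line with three points of \<open>A\<close> is a \<open>t\<close>-secant and so passes
  through \<open>N\<close>, but the join of affine points at different heights meets
  \<open>l\<close> only in a point other than \<open>N\<close>.\<close>

lemma no_three_collinear:
  assumes "fpt M x v 1 \<in> A" "fpt M x' w 1 \<in> A" "v \<noteq> w"
  shows "fpt M ((x + x') / (v + w)) 1 0 \<notin> A"
proof
  define P Q R where "P = fpt M x v 1" "Q = fpt M x' w 1" "R = fpt M ((x + x') / (v + w)) 1 0"
  note PQR = this
  assume "fpt M ((x + x') / (v + w)) 1 0 \<in> A"
  then have A: "{P, Q, R} \<subseteq> A" using assms by (simp add: PQR)
  have J: "pg_join P Q \<inter> l = {R}" using adapted_join_Int [OF ad assms(3)] by (simp add: PQR)
  have PQ: "P \<noteq> Q" using assms M by (simp add: PQR)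
  then have line: "pg_join P Q \<in> pg_lines" using M by (intro pg_join_line) (simp_all add: PQR)
  have "P \<in> pg_join P Q" "Q \<in> pg_join P Q"
    using M by (auto simp: pg_join_def PQR intro: vec.span_base)
  then have "{P, Q, R} \<subseteq> A \<inter> pg_join P Q" using A J by blast
  then have "card {P, Q, R} \<le> card (A \<inter> pg_join P Q)" by (simp add: card_mono)
  moreover have "card {P, Q, R} = 3" using M PQ by (simp add: PQR)
  ultimately have "card (A \<inter> pg_join P Q) = t"
    using km line by (force simp: km_arc_def)
  then have "pg_join P Q \<in> secants t A" using line by (simp add: secants_def)
  then obtain i where "i \<in> {0..4}" "pg_join P Q = L i" using L unfolding bij_betw_def by blast
  then have "N \<in> pg_join P Q \<inter> l" using NL [of i] by (auto simp: l)
  then have "N = R" using J by blast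
  then show False using M by (simp add: PQR N)
qed

end

end

section \<open>The normal form\<close>

context binary_field
begin

text \<open>In characteristic two the condition \<open>x + c \<in> U\<close> describes the coset of
  \<open>c\<close>.\<close>

definition affine_part :: "'a set \<Rightarrow> 'a \<Rightarrow> 'a \<Rightarrow> ('a \<times> 'a) set" where
  "affine_part U c y = {(x, v). (v = 0 \<or> v = 1) \<and> x \<in> U \<or> (v = y \<or> v = y + 1) \<and> x + c \<in> U}"

lemma card_quotient_set:
  assumes "w \<noteq> 0"
  shows "card {s. w * s + e \<in> X} = card (X :: 'a set)"
  by (rule bij_betw_same_card [of "\<lambda>s. w * s + e"], rule bij_betw_byWitness [of _ "\<lambda>x. (x + e) / w"])
    (use assms in \<open>auto simp: add.assoc\<close>)

text \<open>The affine part comes from \<open>coset_arrangement\<close>. The points on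
  \<open>l\<close> are then forced: their parameters avoid three pairwise disjoint direction sets of
  size \<open>t\<close>, and exactly \<open>t\<close> of the \<open>4 * t\<close> parameters
  remain.\<close>

lemma normal_form:
  assumes t: "4 * t = CARD('a)" and km: "km_arc t A" and I: "property_I h t A l"
  obtains M N c y and a :: 'a and U where "adapted M N l" "N \<notin> A" "y \<noteq> 0" "y \<noteq> 1" "Tr (a * c) = 1"
    "U = {x. Tr (a * x) = 0 \<and> Tr (y * a * x) = 0}"
    "\<And>x v. fpt M x v 1 \<in> A \<longleftrightarrow> (x, v) \<in> affine_part U c y"
    "\<And>s. fpt M s 1 0 \<in> A \<longleftrightarrow> s \<notin> U \<and> y * s + c \<notin> U \<and> (y + 1) * s + c \<notin> U"
proof -
  obtain L :: "nat \<Rightarrow> 'a pg_line" and N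
    where L: "bij_betw L {0..4} (secants t A)" "L 0 = l" and N: "\<forall>i\<in>{0..4}. N \<in> L i"
    and D: "dir_set l (L 1 \<inter> A) (L 2 \<inter> A) = dir_set l (L 3 \<inter> A) (L 4 \<inter> A)"
    and clubs: "\<forall>j\<in>{2, 3, 4}. f2_club_with_head (h - 2) (h - 1) l N (dir_set l (L 1 \<inter> A) (L j \<inter> A) \<union> {N})"
    and disj: "dir_set l (L 1 \<inter> A) (L 2 \<inter> A) \<inter> dir_set l (L 1 \<inter> A) (L 3 \<inter> A) = {}"
      "dir_set l (L 1 \<inter> A) (L 2 \<inter> A) \<inter> dir_set l (L 1 \<inter> A) (L 4 \<inter> A) = {}"
      "dir_set l (L 1 \<inter> A) (L 3 \<inter> A) \<inter> dir_set l (L 1 \<inter> A) (L 4 \<inter> A) = {}"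
    using I unfolding property_I_def Let_def by (elim exE conjE) (rule that; assumption)
  have NL: "N \<in> L i" if "i \<in> {0..4}" for i using N that by blast
  have "l \<in> secants t A" using L unfolding bij_betw_def by force
  then have "l \<in> pg_lines" by (simp add: secants_def)
  moreover have "N \<in> l" using NL [of 0] L by simp
  ultimately obtain M0 where ad0: "adapted M0 N l" by (rule exists_adapted)
  have t0: "0 < t" using quarter_powers [OF t] by simp
  note base0 = ad0 t km L NL
  have M0: "invertible M0" and N0: "N = fpt M0 1 0 0" using ad0 by (auto simp: adapted_def)
  obtain y1 y2 where y12: "L 1 = insert N (range (\<lambda>x. fpt M0 x y1 1))" "L 2 = insert N (range (\<lambda>x. fpt M0 x y2 1))"
    using secant_vertical [OF base0, of 1] secant_vertical [OF base0, of 2] by auto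
  have "{x. fpt M0 x y1 1 \<in> A} \<noteq> {}" "{x. fpt M0 x y2 1 \<in> A} \<noteq> {}"
    using secant_coords(1) [OF base0 _ y12(1)] secant_coords(1) [OF base0 _ y12(2)] t0 by force+
  then obtain x1 x2 where x12: "fpt M0 x1 y1 1 \<in> A" "fpt M0 x2 y2 1 \<in> A" by blast
  have L_neq: "L i \<noteq> L j" if "i \<in> {0..4}" "j \<in> {0..4}" "i \<noteq> j" for i j
    using L that unfolding bij_betw_def inj_on_def by blast
  have "y1 \<noteq> y2" using L_neq [of 1 2] y12 by auto
  \<comment> \<open>The new frame moves a point of the arc on the first secant to \<open>(0, 0, 1)\<close> and one on the
    second to \<open>(0, 1, 1)\<close>.\<close>
  define M where "M = M0 ** upper_tri 1 (x1 + x2) x1 (y1 + y2) y1"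
  have ad: "adapted M N l" unfolding M_def using ad0 \<open>y1 \<noteq> y2\<close> by (intro adapted_upper_tri) auto
  note base = ad t km L NL
  have M: "invertible M" and N: "N = fpt M 1 0 0" using ad by (auto simp: adapted_def)
  have f1: "fpt M 0 0 1 = fpt M0 x1 y1 1" and f2: "fpt M 0 1 1 = fpt M0 x2 y2 1"
    by (simp_all add: M_def fpt_upper_tri add_ac)
  have NA: "N \<notin> A" by (rule nucleus_notin [OF base])
  define X where "X v = {x. fpt M x v 1 \<in> A}" for v
  have XI: "0 \<in> X 0" "0 \<in> X 1" using x12 f1 f2 by (simp_all add: X_def)
  have L1: "L 1 = insert N (range (\<lambda>x. fpt M x 0 1))"
    using secant_eq_vertical [OF base, of 1 0 0] y12 f1 by auto
  have L2: "L 2 = insert N (range (\<lambda>x. fpt M x 1 1))"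
    using secant_eq_vertical [OF base, of 2 0 1] y12 f2 by auto
  obtain y y' where L3: "L 3 = insert N (range (\<lambda>x. fpt M x y 1))"
    and L4: "L 4 = insert N (range (\<lambda>x. fpt M x y' 1))"
    using secant_vertical [OF base, of 3] secant_vertical [OF base, of 4] by auto
  have y: "y \<noteq> 0" "y \<noteq> 1" "y' \<noteq> 0" "y' \<noteq> 1" "y \<noteq> y'"
    using L_neq [of 1 3] L_neq [of 2 3] L_neq [of 1 4] L_neq [of 2 4] L_neq [of 3 4] L1 L2 L3 L4 by auto
  have cX: "card (X 0) = t" "card (X 1) = t" "card (X y) = t" "card (X y') = t"
    using secant_coords(1) [OF base _ L1] secant_coords(1) [OF base _ L2]
      secant_coords(1) [OF base _ L3] secant_coords(1) [OF base _ L4] by (simp_all add: X_def)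
  have LA: "L 1 \<inter> A = (\<lambda>x. fpt M x 0 1) ` X 0" "L 2 \<inter> A = (\<lambda>x. fpt M x 1 1) ` X 1"
    "L 3 \<inter> A = (\<lambda>x. fpt M x y 1) ` X y" "L 4 \<inter> A = (\<lambda>x. fpt M x y' 1) ` X y'"
    using secant_coords(2) [OF base _ L1] secant_coords(2) [OF base _ L2]
      secant_coords(2) [OF base _ L3] secant_coords(2) [OF base _ L4] by (simp_all add: X_def)
  \<comment> \<open>\<open>E v w\<close> is the direction set of the sections at heights
    \<open>v\<close> and \<open>w\<close>, expressed by parameters on \<open>l\<close>.\<close>
  define E where "E v w = {(x + x') / (v + w) | x x'. x \<in> X v \<and> x' \<in> X w}" for v w
  have dir: "fpt M s 1 0 \<in> dir_set l S T \<longleftrightarrow> s \<in> E v w"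
    if "v \<noteq> w" "S = (\<lambda>x. fpt M x v 1) ` X v" "T = (\<lambda>x. fpt M x w 1) ` X w" for s v w S T
    unfolding adapted_dir_set [OF ad that] E_def using M by auto
  have E12: "fpt M s 1 0 \<in> dir_set l (L 1 \<inter> A) (L 2 \<inter> A) \<longleftrightarrow> s \<in> E 0 1"
    and E13: "fpt M s 1 0 \<in> dir_set l (L 1 \<inter> A) (L 3 \<inter> A) \<longleftrightarrow> s \<in> E 0 y"
    and E14: "fpt M s 1 0 \<in> dir_set l (L 1 \<inter> A) (L 4 \<inter> A) \<longleftrightarrow> s \<in> E 0 y'"
    and E34: "fpt M s 1 0 \<in> dir_set l (L 3 \<inter> A) (L 4 \<inter> A) \<longleftrightarrow> s \<in> E y y'" for s
    using y y [symmetric] by (simp_all only: dir [OF _ LA(1) LA(2)] dir [OF _ LA(1) LA(3)] dir [OF _ LA(1) LA(4)]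
        dir [OF _ LA(3) LA(4)] zero_neq_one not_False_eq_True)
  have "f2_club_with_head (h - 2) (h - 1) l N (dir_set l (L 1 \<inter> A) (L 2 \<inter> A) \<union> {N})"
    and "f2_club_with_head (h - 2) (h - 1) l N (dir_set l (L 1 \<inter> A) (L 3 \<inter> A) \<union> {N})"
    and "f2_club_with_head (h - 2) (h - 1) l N (dir_set l (L 1 \<inter> A) (L 4 \<inter> A) \<union> {N})"
    using clubs by blast+
  note club = this [THEN club_coordinates(1) [OF ad t]] this(1) [THEN club_coordinates(2) [OF ad t]]
  have cE: "card (E 0 1) = t" "card (E 0 y) = t" "card (E 0 y') = t"
    using club(1-3) by (simp_all only: E12 E13 E14 Collect_mem_eq)
  have E_add: "r + s + u \<in> E 0 1" if "r \<in> E 0 1" "s \<in> E 0 1" "u \<in> E 0 1" for r s u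
    using club(4) [of r s u] that by (simp only: E12)
  have E_disj: "E 0 1 \<inter> E 0 y = {}" "E 0 1 \<inter> E 0 y' = {}" "E 0 y \<inter> E 0 y' = {}"
    using disj E12 E13 E14 by blast+
  have E_eq: "E 0 1 = E y y'" using D E12 E34 by auto
  define U where "U = X 0"
  have EI: "(x + x') / (v + w) \<in> E v w" if "x \<in> X v" "x' \<in> X w" for x x' v w
    using that by (auto simp: E_def)
  \<comment> \<open>Joining with the point 0 at height 1 puts \<open>X 0\<close> inside
    \<open>E 0 1\<close>, and equal sizes give equality. The next step treats \<open>X 1\<close> in
    the same way.\<close>
  have U_E: "U = E 0 1"
  proof (rule card_subset_eq)
    show "U \<subseteq> E 0 1" using EI [of _ 0 0 1] XI by (auto simp: U_def)
  qed (simp_all add: U_def cX cE)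
  have U_X: "X 1 = U" unfolding U_E
  proof (rule card_subset_eq)
    show "X 1 \<subseteq> E 0 1" using EI [of 0 0 _ 1] XI by auto
  qed (simp_all add: cX cE)
  have zero: "0 \<in> U" using XI by (simp add: U_def)
  \<comment> \<open>In a set containing 0, closure under sums of three gives closure under
    addition.\<close>
  then have U_add: "u + v \<in> U" if "u \<in> U" "v \<in> U" for u v
    using E_add [of u v 0] that by (simp add: U_E [symmetric])
  have U: "add_subgroup U" using zero U_add by (simp add: add_subgroup_def)
  have U_card: "4 * card U = CARD('a)" using t cX by (simp add: U_def)
  \<comment> \<open>Two counting arguments: joins with the point 0 at height 0 show that
    \<open>E 0 w\<close> is \<open>X w\<close> divided by \<open>w\<close>; joins of a fixed
    \<open>c \<in> X w\<close> with all of \<open>U\<close> then show that \<open>X w\<close> is the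
    coset of \<open>c\<close>.\<close>
  have coset: "\<exists>c. (\<forall>x. x \<in> X w \<longleftrightarrow> x + c \<in> U) \<and> (\<forall>s. s \<in> E 0 w \<longleftrightarrow> w * s + c \<in> U)"
    if w: "w \<noteq> 0" "card (X w) = t" "card (E 0 w) = t" for w
  proof -
    have "X w \<noteq> {}" using w t0 by auto
    then obtain c where c: "c \<in> X w" by blast
    have sub: "{s. w * s + 0 \<in> X w} \<subseteq> E 0 w"
    proof
      fix s assume "s \<in> {s. w * s + 0 \<in> X w}"
      then have "(0 + w * s) / (0 + w) \<in> E 0 w" using XI by (intro EI) auto
      then show "s \<in> E 0 w" using w by simp
    qed
    then have "{s. w * s + 0 \<in> X w} = E 0 w"
      using w card_quotient_set [of w 0 "X w"] by (intro card_subset_eq) simp_all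
    then have EX: "s \<in> E 0 w \<longleftrightarrow> w * s \<in> X w" for s by auto
    have "{x. 1 * x + c \<in> U} \<subseteq> X w"
    proof
      fix x assume "x \<in> {x. 1 * x + c \<in> U}"
      then have "(x + c + c) / (0 + w) \<in> E 0 w" using c by (intro EI) (auto simp: U_def)
      then show "x \<in> X w" using w by (simp add: EX add.assoc)
    qed
    then have "{x. 1 * x + c \<in> U} = X w"
      using w card_quotient_set [of 1 c U] by (intro card_subset_eq) (simp_all add: U_def cX)
    then have "x \<in> X w \<longleftrightarrow> x + c \<in> U" for x by auto
    then show ?thesis using EX by blast
  qed
  obtain c where c: "\<And>x. x \<in> X y \<longleftrightarrow> x + c \<in> U" "\<And>s. s \<in> E 0 y \<longleftrightarrow> y * s + c \<in> U"
    using coset [of y] y cX cE by blast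
  obtain c' where c': "\<And>x. x \<in> X y' \<longleftrightarrow> x + c' \<in> U" "\<And>s. s \<in> E 0 y' \<longleftrightarrow> y' * s + c' \<in> U"
    using coset [of y'] y cX cE by blast
  \<comment> \<open>The inclusion of \<open>E 0 1\<close> in \<open>E y y'\<close>, rewritten with
    coset representatives.\<close>
  have DU: "\<exists>v\<in>U. u = (c + c' + v) / (y + y')" if "u \<in> U" for u
  proof -
    have "u \<in> E y y'" using that U_E E_eq by simp
    then obtain x x' where "x \<in> X y" "x' \<in> X y'" "u = (x + x') / (y + y')"
      by (auto simp: E_def)
    then have xx: "x + c \<in> U" "x' + c' \<in> U" "u = (x + x') / (y + y')"
      using c(1) c'(1) by blast+
    have "x + x' = c + c' + ((x + c) + (x' + c'))" by (simp add: add_ac)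
    then show ?thesis using xx U_add by metis
  qed
  \<comment> \<open>Equality would make \<open>v\<close> a common parameter of \<open>E 0 1\<close>
    and \<open>E 0 y\<close>.\<close>
  have neq: "c + u \<noteq> y * v" if "u \<in> U" "v \<in> U" for u v
  proof
    assume "c + u = y * v"
    then have "y * v + c = u" by (metis add.commute add.assoc double_left)
    then show False using that c(2) [of v] E_disj U_E by auto
  qed
  have neq': "c' + u \<noteq> y' * v" if "u \<in> U" "v \<in> U" for u v
  proof
    assume "c' + u = y' * v"
    then have "y' * v + c' = u" by (metis add.commute add.assoc double_left)
    then show False using that c'(2) [of v] E_disj U_E by auto
  qed
  obtain a where a: "y' = y + 1" "c + c' \<in> U" "Tr (a * c) = 1"
      "U = {x. Tr (a * x) = 0 \<and> Tr (y * a * x) = 0}"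
    using coset_arrangement [OF U U_card y DU neq neq'] by blast
  \<comment> \<open>As \<open>c + c' \<in> U\<close>, the two cosets coincide, so \<open>c\<close>
    alone serves both heights.\<close>
  have cc: "x + c' \<in> U \<longleftrightarrow> x + c \<in> U" for x
  proof -
    have "x + c' = (x + c) + (c + c')" "x + c = (x + c') + (c + c')" by (simp_all add: add_ac)
    then show ?thesis using U_add a(2) by metis
  qed
  have aff: "fpt M x v 1 \<in> A \<longleftrightarrow> (x, v) \<in> affine_part U c y" for x v
  proof -
    have "v \<in> {0, 1, y, y'}" if vA: "fpt M x v 1 \<in> A"
    proof -
      obtain i where i: "i \<in> {1..4}" "fpt M x v 1 \<in> L i"
        using affine_point_in_secant [OF base vA] by blast
      then have "i = 1 \<or> i = 2 \<or> i = 3 \<or> i = 4" by auto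
      then show ?thesis using i(2) M by (elim disjE; simp only: L1 L2 L3 L4) (auto simp: N)
    qed
    moreover have "fpt M x v 1 \<in> A \<longleftrightarrow> x \<in> X v" by (simp add: X_def)
    ultimately show ?thesis
      using y c(1) c'(1) cc U_X U_def a(1) by (auto simp: affine_part_def)
  qed
  define T where "T = {s. fpt M s 1 0 \<in> A}"
  have T_E: "T \<inter> E v w = {}" if "v \<noteq> w" for v w
    using no_three_collinear [OF base _ _ that] by (auto simp: T_def E_def X_def)
  have "T \<subseteq> - (E 0 1 \<union> E 0 y \<union> E 0 y')"
    using T_E [of 0 1] T_E [of 0 y] T_E [of 0 y'] y by auto
  moreover have "card (- (E 0 1 \<union> E 0 y \<union> E 0 y')) = t"
  proof -
    have "card (E 0 1 \<union> E 0 y \<union> E 0 y') = 3 * t"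
      using E_disj cE by (simp add: card_Un_disjoint Int_Un_distrib2)
    then show ?thesis using t by (simp add: Compl_eq_Diff_UNIV card_Diff_subset)
  qed
  moreover have "card T = t" using card_axis [OF base] by (simp add: T_def)
  ultimately have "T = - (E 0 1 \<union> E 0 y \<union> E 0 y')" by (intro card_subset_eq) simp_all
  then have "fpt M s 1 0 \<in> A \<longleftrightarrow> s \<notin> U \<and> y * s + c \<notin> U \<and> (y + 1) * s + c \<notin> U" for s
    using c(2) [of s] c'(2) [of s] cc a(1) U_E by (auto simp: T_def set_eq_iff)
  with ad NA y(1,2) a(3,4) aff show thesis by (rule that)
qed

end

section \<open>Elations and equivalence\<close>

lemma matrix_image_span:
  fixes T :: "'a::field ^ 'n ^ 'n"
  shows "(\<lambda>v. T *v v) ` vec.span S = vec.span ((\<lambda>v. T *v v) ` S)"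
  by (simp add: vec.linear_span_image [OF matrix_vector_mul_linear_gen])

lemma matrix_inv_inverse:
  assumes "invertible M"
  shows "M ** matrix_inv M = mat 1 \<and> matrix_inv M ** M = mat 1"
  unfolding matrix_inv_def by (rule someI_ex) (use assms in \<open>simp add: invertible_def\<close>)

lemma matrix_inv_mult_vector:
  fixes M :: "'a::field ^ 'n ^ 'n"
  assumes "invertible M"
  shows "matrix_inv M *v (M *v v) = v"
  using assms by (simp add: matrix_vector_mul_assoc matrix_inv_inverse)

section \<open>Translations of the affine plane as elations with axis \<open>l\<close>\<close>

definition pg_translation :: "'a::field ^ 3 ^ 3 \<Rightarrow> 'a \<Rightarrow> 'a \<Rightarrow> 'a pg_point \<Rightarrow> 'a pg_point" where
  "pg_translation M d e P = (\<lambda>v. (M ** upper_tri 1 0 d 1 e ** matrix_inv M) *v v) ` P"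

lemma pg_translation_fpt:
  assumes "invertible M"
  shows "pg_translation M d e (fpt M x y z) = fpt M (x + d * z) (y + e * z) z"
  unfolding pg_translation_def fpt_def matrix_image_span
  using assms
  by (simp add: matrix_vector_mul_assoc [symmetric] matrix_inv_mult_vector upper_tri_mult)

lemma adapted_infinite_point:
  assumes "adapted M N l" "(d, e) \<noteq> (0, 0)"
  shows "fpt M d e 0 \<in> l"
proof (cases "e = 0")
  case True
  then have "fpt M d e 0 = fpt M 1 0 0"
    using assms fpt_eq_iff [of M d e 0 1 0 0] by (auto simp: adapted_def)
  then show ?thesis using assms by (simp add: adapted_def)
next
  case False
  then have "fpt M d e 0 = fpt M (d / e) 1 0"
    using assms fpt_eq_iff [of M d e 0 "d / e" 1 0] by (auto simp: adapted_def)
  then show ?thesis using assms by (simp add: adapted_def)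
qed

context binary_field
begin

context
  fixes M :: "'a ^ 3 ^ 3" and N l d e and f :: "'a pg_point \<Rightarrow> 'a pg_point"
  assumes ad: "adapted M N l" and l: "l \<in> pg_lines"
    and f: "f = pg_translation M d e"
begin

private lemma frame_inv: "invertible M" and N_eq: "N = fpt M 1 0 0"
  and l_eq: "l = insert N (range (\<lambda>s. fpt M s 1 0))"
  using ad by (auto simp: adapted_def)

private lemma f_fpt: "f (fpt M x y z) = fpt M (x + d * z) (y + e * z) z"
  using pg_translation_fpt [OF frame_inv] by (simp add: f)

private lemma f_point: "f P \<in> pg_points" if "P \<in> pg_points"
  using frame_inv that by (cases rule: fpt_cases) (simp_all add: f_fpt frame_inv)

text \<open>In characteristic two the translation vector doubles to 0. Hence \<open>f\<close> is its
  own inverse, which yields bijectivity and upgrades inclusions of images to equalities.\<close>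

lemma translation_involution: "f (f P) = P" if "P \<in> pg_points"
  using frame_inv that by (cases rule: fpt_cases) (simp_all add: f_fpt frame_inv add.assoc)

lemma translation_image_eqI: "f ` S = S" if "f ` S \<subseteq> S" "S \<subseteq> pg_points"
proof
  show "S \<subseteq> f ` S"
  proof
    fix P assume "P \<in> S"
    then have "f P \<in> S" "P = f (f P)" using that translation_involution by auto
    then show "P \<in> f ` S" by blast
  qed
qed (rule that(1))

private lemma f_join: "f ` pg_join P Q \<subseteq> pg_join (f P) (f Q)"
proof
  fix R assume "R \<in> f ` pg_join P Q"
  then obtain R' where R: "R = f R'" "R' \<in> pg_points" "R' \<subseteq> vec.span (P \<union> Q)"
    by (auto simp: pg_join_def)
  have "f R' \<subseteq> vec.span (f P \<union> f Q)"
    unfolding f pg_translation_def image_Un [symmetric] matrix_image_span [symmetric]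
    using R(3) by (rule image_mono)
  then show "R \<in> pg_join (f P) (f Q)" using R f_point by (simp add: pg_join_def)
qed

text \<open>The centre is the point at infinity in direction \<open>(d, e)\<close>, because an
  affine point, its image and this point are collinear. For \<open>d = e = 0\<close> the map fixes
  every point and any centre on \<open>l\<close> will do.\<close>

lemma elation_translation: "pg_elation l f"
proof -
  have bij: "bij_betw f pg_points pg_points"
    by (rule bij_betw_byWitness [of _ f]) (auto simp: translation_involution f_point)
  have line: "f ` m \<in> pg_lines" if m: "m \<in> pg_lines" for m
  proof -
    have "m \<noteq> {}"
    proof
      assume "m = {}"
      obtain U where "vec.subspace U" "vec.dim U = 2" "m = {P \<in> pg_points. P \<subseteq> U}"
        using m by (auto simp: pg_lines_def)
      moreover then obtain u where "u \<in> U" "u \<noteq> 0"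
        by (metis vec.dim_eq_0 zero_neq_numeral singletonI subsetI)
      ultimately have "vec.span {u} \<in> m" by (auto simp: pg_points_iff span_singleton_subset_iff)
      then show False using \<open>m = {}\<close> by simp
    qed
    then obtain P where P: "P \<in> m" by blast
    obtain Q where Q: "Q \<in> m" "Q \<noteq> P" using pg_line_second_point [OF m P] .
    have pts: "P \<in> pg_points" "Q \<in> pg_points" using P Q m pg_line_subset_points by blast+
    have mj: "m = pg_join P Q" using pg_line_eq_join m P Q by blast
    have "f ` pg_join P Q = pg_join (f P) (f Q)"
    proof
      show "pg_join (f P) (f Q) \<subseteq> f ` pg_join P Q"
      proof
        fix R assume R: "R \<in> pg_join (f P) (f Q)"
        then have "f R \<in> pg_join (f (f P)) (f (f Q))" using f_join by blast
        then have "f R \<in> pg_join P Q" using pts by (simp add: translation_involution)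
        moreover have "R = f (f R)" using R translation_involution by (simp add: pg_join_def)
        ultimately show "R \<in> f ` pg_join P Q" by blast
      qed
    qed (rule f_join)
    moreover have "f P \<noteq> f Q" using Q pts translation_involution by metis
    ultimately show ?thesis unfolding mj using pg_join_line f_point pts by metis
  qed
  have fix_l: "f P = P" if "P \<in> l" for P
    using that by (auto simp: l_eq N_eq f_fpt)
  have "\<exists>C\<in>l. \<forall>m\<in>pg_lines. C \<in> m \<longrightarrow> f ` m = m"
  proof (cases "(d, e) = (0, 0)")
    case True
    have "f P = P" if "P \<in> pg_points" for P
      using frame_inv that by (cases rule: fpt_cases) (use True in \<open>simp_all add: f_fpt\<close>)
    then have "f ` m = m" if "m \<in> pg_lines" for m
      using pg_line_subset_points [OF that] by force
    then show ?thesis using l_eq by blast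
  next
    case False
    define C where "C = fpt M d e 0"
    have C: "C \<in> l" using adapted_infinite_point [OF ad False] by (simp add: C_def)
    have "f ` m = m" if m: "m \<in> pg_lines" "C \<in> m" for m
    proof (rule translation_image_eqI)
      show "m \<subseteq> pg_points" using m pg_line_subset_points by blast
      show "f ` m \<subseteq> m"
      proof
        fix Q assume "Q \<in> f ` m"
        then obtain R where R: "R \<in> m" "Q = f R" by blast
        have "R \<in> pg_points" using R m pg_line_subset_points by blast
        with frame_inv show "Q \<in> m"
        proof (cases rule: fpt_cases)
          case (1 x y)
          have "fpt M x y 1 \<notin> l" using frame_inv by (auto simp: l_eq N_eq)
          then have "R \<noteq> C" using C 1 by auto
          then have "m = pg_join R C" using pg_line_eq_join m R by blast
          moreover have "f R \<in> pg_join R C"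
            unfolding 1 f_fpt C_def by (simp add: fpt_in_join frame_inv) (intro exI [of _ 1], simp)
          ultimately show ?thesis using R by simp
        next
          case (2 s)
          then show ?thesis using R by (simp add: f_fpt)
        next
          case 3
          then show ?thesis using R by (simp add: f_fpt)
        qed
      qed
    qed
    then show ?thesis using C by blast
  qed
  then show ?thesis
    using bij line fix_l by (simp add: pg_elation_def pg_collineation_def)
qed

end

section \<open>The affine part of the arc as a group of translations\<close>

lemma affine_part_iff:
  "(x, v) \<in> affine_part U c y \<longleftrightarrow> (\<exists>i\<in>{0, 1}. \<exists>j\<in>{0, 1}. v = i + j * y \<and> x + j * c \<in> U)"
  by (auto simp: affine_part_def add.commute)

text \<open>In the form with height \<open>i + j * y\<close>, where \<open>j\<close> also selects
  the coset, both conditions are additive in \<open>i\<close> and \<open>j\<close>.\<close>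

lemma affine_part_add:
  assumes U: "add_subgroup U" and p: "(x, v) \<in> affine_part U c y" "(x', v') \<in> affine_part U c y"
  shows "(x + x', v + v') \<in> affine_part U c y"
proof -
  obtain i j where ij: "i \<in> {0, 1}" "j \<in> {0, 1}" "v = i + j * y" "x + j * c \<in> U"
    using p affine_part_iff by blast
  obtain i' j' where ij': "i' \<in> {0, 1}" "j' \<in> {0, 1}" "v' = i' + j' * y" "x' + j' * c \<in> U"
    using p affine_part_iff by blast
  have "v + v' = (i + i') + (j + j') * y" by (simp add: ij ij' algebra_simps)
  moreover have "(x + j * c) + (x' + j' * c) \<in> U" using U ij ij' by (simp add: add_subgroup_def)
  then have "(x + x') + (j + j') * c \<in> U" by (simp add: algebra_simps)
  moreover have "i + i' \<in> {0, 1}" "j + j' \<in> {0, 1}" using ij ij' by auto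
  ultimately show ?thesis unfolding affine_part_iff by blast
qed

text \<open>The translation taking \<open>P\<close> to \<open>Q\<close> has its vector in the group
  of affine points, so it preserves the affine part of \<open>A\<close>, and it fixes the points of
  \<open>l\<close>.\<close>

lemma translation_set_normal_form:
  fixes M :: "'a ^ 3 ^ 3"
  assumes ad: "adapted M N l" and l: "l \<in> pg_lines" and A: "A \<subseteq> pg_points" and U: "add_subgroup U"
    and aff: "\<And>x v. fpt M x v 1 \<in> A \<longleftrightarrow> (x, v) \<in> affine_part U c y"
  shows "translation_set A l"
  unfolding translation_set_def
proof (intro conjI ballI)
  have M: "invertible M" and N: "N = fpt M 1 0 0" and l_eq: "l = insert N (range (\<lambda>s. fpt M s 1 0))"
    using ad by (auto simp: adapted_def)
  fix P Q assume PQ: "P \<in> A - l" "Q \<in> A - l"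
  have affine: "\<exists>x v. R = fpt M x v 1" if "R \<in> A - l" for R
  proof -
    have "R \<in> pg_points" using that A by blast
    with M show ?thesis by (cases rule: fpt_cases) (use that in \<open>auto simp: l_eq N\<close>)
  qed
  obtain x v x' v' where P: "P = fpt M x v 1" and Q: "Q = fpt M x' v' 1"
    using affine PQ by blast
  define f where "f = pg_translation M (x + x') (v + v')"
  have D: "(x + x', v + v') \<in> affine_part U c y"
    using PQ aff P Q by (intro affine_part_add [OF U]) auto
  have "f ` A \<subseteq> A"
  proof
    fix S assume "S \<in> f ` A"
    then obtain R where R: "R \<in> A" "S = f R" by blast
    then have "R \<in> pg_points" using A by blast
    with M show "S \<in> A"
    proof (cases rule: fpt_cases)
      case (1 z w)
      then have "(z, w) \<in> affine_part U c y" using R aff by blast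
      then have "(z + (x + x'), w + (v + v')) \<in> affine_part U c y"
        using D by (rule affine_part_add [OF U])
      then show ?thesis
        using R 1 by (simp add: f_def pg_translation_fpt M aff)
    qed (use R in \<open>simp_all add: f_def pg_translation_fpt M\<close>)
  qed
  then have "f ` A = A" using translation_image_eqI [OF ad l f_def] A by blast
  moreover have "f P = Q" by (simp add: P Q f_def pg_translation_fpt M add.left_commute)
  ultimately show "\<exists>f. pg_elation l f \<and> f ` A = A \<and> f P = Q"
    using elation_translation [OF ad l f_def] by blast
qed (use A l in auto)

section \<open>The members of the family with \<open>\<beta> = y\<close> and
  \<open>\<alpha> = 1 / y^2\<close>, and equivalence with the arc\<close>

lemma arc_family_special:
  fixes y :: 'a
  assumes y: "y \<noteq> 0" "y \<noteq> 1"
  shows "arc_family h (1 / y\<^sup>2) y a b =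
    {pg_pt z 1 0 | z. Tr z = 0 \<and> Tr (y * y * z) = a} \<union>
    {pg_pt z 0 1 | z. Tr z = 0 \<and> Tr (y * z) = 0} \<union>
    {pg_pt z 1 1 | z. Tr z = 1 \<and> Tr (y * z) = b} \<union>
    {pg_pt z y 1 | z. Tr (y * z) = a + 1 \<and> Tr z = b + 1} \<union>
    {pg_pt z (y + 1) 1 | z. Tr (y * z) = a + b + 1 \<and> Tr z = b}"
proof -
  \<comment> \<open>For these parameters \<open>\<alpha> * \<beta>\<close> and
    \<open>\<alpha> * \<gamma>\<close> are both \<open>1 / y\<close>, while
    \<open>\<gamma> = y\<close> and \<open>\<xi> = 1\<close>.\<close>
  have 1: "1 / y\<^sup>2 * y = 1 / y" using y by (simp add: power2_eq_square)
  have "1 / y + 1 = (y + 1) / y" using y by (simp add: add_divide_distrib add.commute)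
  then have 2: "(y + 1) / (1 / y + 1) = y" using y by simp
  have 3: "z / (1 / y\<^sup>2) = y * y * z" "z / (1 / y) = y * z" for z
    by (simp_all add: power2_eq_square mult_ac)
  have 4: "1 / y * y = 1" using y by simp
  show ?thesis unfolding arc_family_def Let_def 1 2 3 4 div_by_1 ..
qed

text \<open>Scaling by \<open>1 / k\<close> turns \<open>Tr (k * x)\<close> into \<open>Tr\<close>,
  and the shear by \<open>m\<close> with \<open>Tr m = 1\<close> moves the section at height 1 to
  trace 1, as the family requires. The value of \<open>b\<close> is read off at height 1, and that
  of \<open>a\<close> at height \<open>y\<close>.\<close>

lemma pgl_equivalent_normal_form:
  fixes M :: "'a ^ 3 ^ 3"
  assumes ad: "adapted M N l" and A: "A \<subseteq> pg_points" and NA: "N \<notin> A"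
    and y: "y \<noteq> 0" "y \<noteq> 1" and ac: "Tr (k * c) = 1"
    and U: "U = {x. Tr (k * x) = 0 \<and> Tr (y * k * x) = 0}"
    and aff: "\<And>x v. fpt M x v 1 \<in> A \<longleftrightarrow> (x, v) \<in> affine_part U c y"
    and axis: "\<And>s. fpt M s 1 0 \<in> A \<longleftrightarrow> s \<notin> U \<and> y * s + c \<notin> U \<and> (y + 1) * s + c \<notin> U"
    and m: "Tr m = 1" and a: "a = Tr (y * y * m) + Tr (y * k * c) + 1" and b: "b = Tr (y * m)"
  shows "pgl_equivalent A (arc_family h (1 / y\<^sup>2) y a b)"
proof -
  have k: "k \<noteq> 0" using ac by auto
  define M' where "M' = M ** upper_tri (1 / k) (m / k) 0 1 0"
  have ad': "adapted M' N l" unfolding M'_def using ad k by (intro adapted_upper_tri) auto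
  have M: "invertible M'" and N: "N = fpt M' 1 0 0" using ad' by (auto simp: adapted_def)
  have old: "fpt M' x v z = fpt M ((x + m * v) / k) v z" for x v z
    by (simp add: M'_def fpt_upper_tri add_divide_distrib mult.commute)
  \<comment> \<open>The factor \<open>r\<close> will be 1, \<open>y\<close> or \<open>y + 1\<close>,
    and the offset \<open>j\<close> will be 0 or \<open>c\<close>.\<close>
  have inU: "r * (s / k) + j \<in> U \<longleftrightarrow> Tr (r * s) = Tr (k * j) \<and> Tr (y * (r * s)) = Tr (y * k * j)" for r s j
  proof -
    have "k * (r * (s / k) + j) = r * s + k * j" "y * k * (r * (s / k) + j) = y * (r * s) + y * k * j"
      using k by (simp_all add: algebra_simps)
    then show ?thesis by (simp add: U)
  qed
  have inU': "s / k + j \<in> U \<longleftrightarrow> Tr s = Tr (k * j) \<and> Tr (y * s) = Tr (y * k * j)" for s j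
    using inU [of 1 s j] by simp
  have inU'': "s / k \<in> U \<longleftrightarrow> Tr s = 0 \<and> Tr (y * s) = 0" for s
    using inU [of 1 s 0] by simp
  have "fpt M' z 1 0 \<in> A \<longleftrightarrow> Tr z = 0 \<and> Tr (y * y * z) = a" for z
  proof -
    have "Tr (z + m) = Tr z + 1" "Tr (y * (z + m)) = Tr (y * z) + Tr (y * m)"
      "Tr (y * (y * (z + m))) = Tr (y * y * z) + Tr (y * y * m)"
      "Tr ((y + 1) * (z + m)) = Tr (y * z) + Tr (y * m) + (Tr z + 1)"
      "Tr (y * ((y + 1) * (z + m))) = Tr (y * y * z) + Tr (y * y * m) + (Tr (y * z) + Tr (y * m))"
      by (simp_all add: m algebra_simps)
    note Tr_eqs = this
    have "fpt M' z 1 0 \<in> A \<longleftrightarrow> \<not> (Tr (z + m) = 0 \<and> Tr (y * (z + m)) = 0) \<and>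
        \<not> (Tr (y * (z + m)) = 1 \<and> Tr (y * (y * (z + m))) = Tr (y * k * c)) \<and>
        \<not> (Tr ((y + 1) * (z + m)) = 1 \<and> Tr (y * ((y + 1) * (z + m))) = Tr (y * k * c))"
      unfolding old axis inU inU'' mult_1_right ac by blast
    \<comment> \<open>Once every trace is reduced to the basic ones, each of them 0 or 1, the
      equivalence is verified on all combinations of values.\<close>
    then show ?thesis
      unfolding Tr_eqs a
      using Tr_cases [of z] Tr_cases [of "y * z"] Tr_cases [of "y * m"] Tr_cases [of "y * y * z"]
        Tr_cases [of "y * y * m"] Tr_cases [of "y * k * c"] by (elim disjE) simp_all
  qed
  then have 1: "{fpt M' z 1 0 | z. Tr z = 0 \<and> Tr (y * y * z) = a} = A \<inter> range (\<lambda>z. fpt M' z 1 0)"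
    by auto
  have "fpt M' z 0 1 \<in> A \<longleftrightarrow> Tr z = 0 \<and> Tr (y * z) = 0" for z
    using y unfolding old aff by (simp add: affine_part_def inU'')
  then have 2: "{fpt M' z 0 1 | z. Tr z = 0 \<and> Tr (y * z) = 0} = A \<inter> range (\<lambda>z. fpt M' z 0 1)"
    by auto
  have "fpt M' z 1 1 \<in> A \<longleftrightarrow> Tr z = 1 \<and> Tr (y * z) = b" for z
    using y unfolding old aff by (simp add: affine_part_def inU'' m b distrib_left)
  then have 3: "{fpt M' z 1 1 | z. Tr z = 1 \<and> Tr (y * z) = b} = A \<inter> range (\<lambda>z. fpt M' z 1 1)"
    by auto
  have "fpt M' z y 1 \<in> A \<longleftrightarrow> Tr (y * z) = a + 1 \<and> Tr z = b + 1" for z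
  proof -
    have "Tr (z + m * y) = Tr z + Tr (y * m)" "Tr (y * (z + m * y)) = Tr (y * z) + Tr (y * y * m)"
      by (simp_all add: m algebra_simps)
    note Tr_eqs = this
    have "fpt M' z y 1 \<in> A \<longleftrightarrow>
        Tr (z + m * y) = 1 \<and> Tr (y * (z + m * y)) = Tr (y * k * c)"
      using y unfolding old aff by (simp add: affine_part_def inU' ac)
    then show ?thesis
      unfolding Tr_eqs a b
      using Tr_cases [of z] Tr_cases [of "y * z"] Tr_cases [of "y * m"]
        Tr_cases [of "y * y * m"] Tr_cases [of "y * k * c"] by (elim disjE) simp_all
  qed
  then have 4: "{fpt M' z y 1 | z. Tr (y * z) = a + 1 \<and> Tr z = b + 1} = A \<inter> range (\<lambda>z. fpt M' z y 1)"
    by auto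
  have "fpt M' z (y + 1) 1 \<in> A \<longleftrightarrow> Tr (y * z) = a + b + 1 \<and> Tr z = b" for z
  proof -
    have "Tr (z + m * (y + 1)) = Tr z + Tr (y * m) + 1" "Tr (y * (z + m * (y + 1))) = Tr (y * z) + Tr (y * y * m) + Tr (y * m)"
      by (simp_all add: m algebra_simps)
    note Tr_eqs = this
    have "fpt M' z (y + 1) 1 \<in> A \<longleftrightarrow>
        Tr (z + m * (y + 1)) = 1 \<and> Tr (y * (z + m * (y + 1))) = Tr (y * k * c)"
      using y unfolding old aff by (simp add: affine_part_def inU' ac)
    then show ?thesis
      unfolding Tr_eqs a b
      using Tr_cases [of z] Tr_cases [of "y * z"] Tr_cases [of "y * m"]
        Tr_cases [of "y * y * m"] Tr_cases [of "y * k * c"] by (elim disjE) simp_all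
  qed
  then have 5: "{fpt M' z (y + 1) 1 | z. Tr (y * z) = a + b + 1 \<and> Tr z = b} = A \<inter> range (\<lambda>z. fpt M' z (y + 1) 1)"
    by auto
  \<comment> \<open>The five pieces exhaust \<open>A\<close>: affine points occur at four heights
    only, and \<open>N\<close> is not in \<open>A\<close>.\<close>
  have "A \<subseteq> range (\<lambda>z. fpt M' z 1 0) \<union> range (\<lambda>z. fpt M' z 0 1) \<union> range (\<lambda>z. fpt M' z 1 1) \<union>
      range (\<lambda>z. fpt M' z y 1) \<union> range (\<lambda>z. fpt M' z (y + 1) 1)"
  proof
    fix P assume P: "P \<in> A"
    then have "P \<in> pg_points" using A by blast
    with M show "P \<in> range (\<lambda>z. fpt M' z 1 0) \<union> range (\<lambda>z. fpt M' z 0 1) \<union> range (\<lambda>z. fpt M' z 1 1) \<union>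
      range (\<lambda>z. fpt M' z y 1) \<union> range (\<lambda>z. fpt M' z (y + 1) 1)"
    proof (cases rule: fpt_cases)
      case (1 x v)
      then have "v \<in> {0, 1, y, y + 1}" using P unfolding old aff 1 by (auto simp: affine_part_def)
      then show ?thesis using 1 by auto
    qed (use P NA N in auto)
  qed
  then have A_eq: "A = {fpt M' z 1 0 | z. Tr z = 0 \<and> Tr (y * y * z) = a} \<union>
    {fpt M' z 0 1 | z. Tr z = 0 \<and> Tr (y * z) = 0} \<union>
    {fpt M' z 1 1 | z. Tr z = 1 \<and> Tr (y * z) = b} \<union>
    {fpt M' z y 1 | z. Tr (y * z) = a + 1 \<and> Tr z = b + 1} \<union>
    {fpt M' z (y + 1) 1 | z. Tr (y * z) = a + b + 1 \<and> Tr z = b}"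
    unfolding 1 2 3 4 5 by blast
  \<comment> \<open>The inverse frame matrix carries the coordinates of \<open>M'\<close> to the
    standard ones; it is the required projectivity.\<close>
  define g where "g = (\<lambda>P. (\<lambda>v. matrix_inv M' *v v) ` P)"
  have g: "g (fpt M' x v z) = pg_pt x v z" for x v z
    using M by (simp add: g_def fpt_def pg_pt_def matrix_image_span matrix_inv_mult_vector)
  have im: "g ` {fpt M' z v w | z. R z} = {pg_pt z v w | z. R z}" for v w R
    by (auto simp: g [symmetric])
  have "g ` A = arc_family h (1 / y\<^sup>2) y a b"
    unfolding arc_family_special [OF y] by (subst A_eq) (simp only: image_Un im)
  moreover have "invertible (matrix_inv M')"
    using matrix_inv_inverse [OF M] unfolding invertible_def by blast
  ultimately show ?thesis unfolding pgl_equivalent_def g_def by blast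
qed

end

theorem theorem4p13:
  fixes h t :: nat
    and A :: "('a::{field,finite}) pg_point set"
    and l :: "'a pg_line"
  assumes "CARD('a) = 2 ^ h"
    and "4 * t = CARD('a)"
    and "km_arc t A"
    and "l \<in> secants t A"
    and "property_I h t A l"
  shows "(\<exists>\<alpha> \<beta> a b :: 'a. \<alpha> \<notin> {0, 1} \<and> \<beta> \<notin> {0, 1} \<and> \<alpha> * \<beta> \<noteq> 1 \<and> \<alpha> * \<beta>\<^sup>2 = 1 \<and>
            a \<in> {0, 1} \<and> b \<in> {0, 1} \<and> pgl_equivalent A (arc_family h \<alpha> \<beta> a b)) \<and>
         translation_km_arc t A l"
proof -
  interpret binary_field h "TYPE('a)" by unfold_locales (rule assms(1))
  obtain M N c y k U where ad: "adapted M N l" and NA: "N \<notin> A" and y: "y \<noteq> 0" "y \<noteq> 1"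
    and kc: "Tr (k * c) = 1"
    and U: "U = {x. Tr (k * x) = 0 \<and> Tr (y * k * x) = 0}"
    and aff: "\<And>x v. fpt M x v 1 \<in> A \<longleftrightarrow> (x, v) \<in> affine_part U c y"
    and axis: "\<And>s. fpt M s 1 0 \<in> A \<longleftrightarrow> s \<notin> U \<and> y * s + c \<notin> U \<and> (y + 1) * s + c \<notin> U"
    by (rule normal_form [OF assms(2,3,5)]) blast
  have A: "A \<subseteq> pg_points" using assms(3) by (simp add: km_arc_def)
  have l: "l \<in> pg_lines" using assms(4) by (simp add: secants_def)
  \<comment> \<open>Any element of trace 1 serves as the shear parameter; its choice enters into
    \<open>a\<close> and \<open>b\<close>.\<close>
  obtain m where m: "Tr m = 1" using Tr_surj by blast
  define a where "a = Tr (y * y * m) + Tr (y * k * c) + 1"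
  define b where "b = Tr (y * m)"
  have "a \<in> {0, 1}" "b \<in> {0, 1}"
    using Tr_cases [of "y * y * m"] Tr_cases [of "y * k * c"] Tr_cases [of "y * m"]
    by (auto simp: a_def b_def)
  moreover have "pgl_equivalent A (arc_family h (1 / y\<^sup>2) y a b)"
    using pgl_equivalent_normal_form [OF ad A NA y kc U aff axis m a_def b_def] .
  moreover have "1 / y\<^sup>2 * y \<noteq> 1" "1 / y\<^sup>2 * y\<^sup>2 = 1"
    using y by (simp_all add: power2_eq_square)
  \<comment> \<open>In characteristic two, \<open>y * y = 1\<close> means that the square of
    \<open>y + 1\<close> is 0.\<close>
  moreover have "1 / y\<^sup>2 \<noteq> 1"
  proof
    assume "1 / y\<^sup>2 = 1"
    then have "y * y = 1" using y by (simp add: power2_eq_square)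
    then have "(y + 1) * (y + 1) = 0" by (simp add: algebra_simps)
    then show False using y by simp
  qed
  moreover have "1 / y\<^sup>2 \<noteq> 0" using y by simp
  moreover have "add_subgroup U" by (auto simp: U add_subgroup_def distrib_left)
  then have "translation_set A l" using translation_set_normal_form [OF ad l A _ aff] by blast
  ultimately show ?thesis
    using assms(3) y unfolding translation_km_arc_def by blast
qed

end
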